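(* Let $G$ be a finite simple cubic graph, $\Pi$ a polyhedral embedding of $G$, and $G^e=G^e(\Pi)$. Suppose $G^e$ contains a butterfly two on vertices $t_0,t_{0'},t_1,t_2,t_3,t_4,t_{4'},t_5,t_{5'}$ with $[t_{0'}t_3]$ not a scaffold edge, and that the disjunction of the fork $(t_1,t_2,t_3,t_4,t_{4'})$ cannot be solved. Let $x_0,x_2,x_5$ denote the neighbours of $t_0,t_2,t_5$ respectively not lying on the cycle $(t_0t_1t_2t_3t_4t_5t_0)$. Then $G$ is isomorphic to the Franklin graph, and the scaffold multiset $\mathcal S$ of $G^e$ consists exactly of the single scaffold edges $[t_0t_5],[t_5x_5],[x_5x_0],[x_0t_0],[t_1t_2],[t_2x_2],[x_2t_{0'}],[t_{0'}t_1],[t_3t_{4'}],[t_{4'}t_{5'}],[t_{5'}t_4],[t_4t_3]$ (multiplicity one each) and the double scaffold edges $[t_0t_3],[x_0t_2],[t_1t_{4'}],[t_{0'}t_5],[t_4x_2],[x_5t_{5'}],[t_0t_{5'}],[t_1t_4],[t_2t_5],[t_3x_5],[t_{4'}x_2],[x_0t_{0'}]$ (multiplicity two each).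
   Context: An embedding of a graph in a surface without boundary is polyhedral if every facial walk is a cycle and any two distinct facial cycles intersect in either the empty set, a single vertex, or a single edge. A $\Pi$-facial subwalk is a walk formed by consecutive vertices of some $\Pi$-facial cycle (in either direction). The extended graph $G^e(\Pi)$ has vertex set $V(G)$ and edge set $E(G)$ together with a multiset $\mathcal S$ of scaffold edges: for distinct vertices $t_0,t_3$, $[t_0t_3]$ appears with multiplicity equal to the number of paths $(t_0t_1t_2t_3)$ of $G$ that are $\Pi$-facial subwalks (single if multiplicity $1$, double if $2$). A fork $(a_1,a_2,a_3,a_4,a_{4'})$ in $G^e$ consists of five distinct vertices such that $a_1a_2,a_2a_3,a_3a_4,a_3a_{4'}$ are edges of $G$ and $[a_1a_4],[a_1a_{4'}]$ are scaffold edges; its disjunction can be solved if either every polyhedral embedding $\Pi'$ of $G$ with $G^e(\Pi')=G^e$ has $(a_1a_2a_3a_4)$ as a $\Pi'$-facial subwalk, or every such $\Pi'$ has $(a_1a_2a_3a_{4'})$ as a $\Pi'$-facial subwalk; otherwise it cannot be solved. A butterfly two in $G^e$ consists of nine distinct vertices $t_0,t_{0'},t_1,t_2,t_3,t_4,t_{4'},t_5,t_{5'}$ such that $(t_0t_1t_2t_3t_4t_5t_0)$ and $(t_{0'}t_1t_2t_3t_{4'}t_{5'}t_{0'})$ are $6$-cycles of $G$ and $[t_1t_4],[t_1t_{4'}],[t_0t_3]$ are scaffold edges. *)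

theory Defs
  imports
    "Graph_Theory.Digraph_Isomorphism"
    "Graph_Theory.Vertex_Walk"
    "HOL-Combinatorics.Orbits"
    "HOL-Library.Multiset"
    "HOL-Library.Sublist"
begin

text \<open>
  A finite simple graph is a \<^locale>\<open>pair_graph\<close>: a finite, loop-free, symmetric digraph whose
  arcs are pairs of vertices.
\<close>

abbreviation nbrs :: "'a pair_pre_digraph \<Rightarrow> 'a \<Rightarrow> 'a set" where
  "nbrs G v \<equiv> {u. (v, u) \<in> parcs G}"

definition cubic :: "'a pair_pre_digraph \<Rightarrow> bool" where
  "cubic G \<longleftrightarrow> (\<forall>v \<in> pverts G. out_degree (with_proj G) v = 3)"

text \<open>
  A cycle is given by the list of its vertices, the first one not being repeated at the end.
  (The library notion of a cycle in a symmetric digraph admits u, v, u; hence the length bound.)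
\<close>

definition is_cycle :: "'a pair_pre_digraph \<Rightarrow> 'a list \<Rightarrow> bool" where
  "is_cycle G c \<longleftrightarrow> 3 \<le> length c \<and> distinct c \<and> vwalk (c @ [hd c]) (with_proj G)"

definition cycle_edges :: "'a list \<Rightarrow> 'a set set" where
  "cycle_edges c = {{u, v} |u v. (u, v) \<in> set (vwalk_arcs (c @ [hd c]))}"

text \<open>
  A (2-cell) embedding of a connected graph in a closed surface, orientable or not, is represented
  by an embedding scheme: at each vertex a cyclic permutation of its neighbours (the rotation),
  and for each edge a sign, where \<^const>\<open>True\<close> stands for +1 (the local orientations at the two
  ends agree) and \<^const>\<open>False\<close> for -1.
\<close>

record 'a embedding =
  rotation :: "'a \<Rightarrow> 'a \<Rightarrow> 'a"
  signature :: "'a set \<Rightarrow> bool"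

definition is_embedding :: "'a pair_pre_digraph \<Rightarrow> 'a embedding \<Rightarrow> bool" where
  "is_embedding G \<Phi> \<longleftrightarrow> Digraph_Component.connected (with_proj G) \<and>
     (\<forall>v \<in> pverts G. rotation \<Phi> v permutes nbrs G v \<and> cyclic_on (rotation \<Phi> v) (nbrs G v))"

text \<open>
  Face traversal. The state (u, v, s) means that the edge uv is about to be traversed from u to v,
  turning clockwise (with the rotation) if s holds and anticlockwise otherwise; traversing an edge
  of sign -1 switches between the two.
\<close>

fun face_step :: "'a embedding \<Rightarrow> 'a \<times> 'a \<times> bool \<Rightarrow> 'a \<times> 'a \<times> bool" where
  "face_step \<Phi> (u, v, s) =
     (let s' = (if signature \<Phi> {u, v} then s else \<not> s)
      in (v, (if s' then rotation \<Phi> v u else inv (rotation \<Phi> v) u), s'))"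

text \<open>
  The closed walk traced until the initial state recurs. \<^term>\<open>funpow_dist1 f d d\<close> is the least
  n > 0 with \<^term>\<open>(f ^^ n) d = d\<close>.
\<close>

definition facial_walk :: "'a embedding \<Rightarrow> 'a \<times> 'a \<times> bool \<Rightarrow> 'a list" where
  "facial_walk \<Phi> d =
     map (\<lambda>i. fst ((face_step \<Phi> ^^ i) d)) [0..<funpow_dist1 (face_step \<Phi>) d d]"

text \<open>Each face occurs here with every starting point and in both directions.\<close>

definition facial_walks :: "'a pair_pre_digraph \<Rightarrow> 'a embedding \<Rightarrow> 'a list set" where
  "facial_walks G \<Phi> = {facial_walk \<Phi> (u, v, s) |u v s. (u, v) \<in> parcs G}"

text \<open>
  Two facial walks are distinct as cycles iff their edge sets differ. In a cubic graph distinct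
  faces never have the same boundary cycle, because two edges at a vertex bound only one
  common corner.
\<close>

definition polyhedral_embedding :: "'a pair_pre_digraph \<Rightarrow> 'a embedding \<Rightarrow> bool" where
  "polyhedral_embedding G \<Phi> \<longleftrightarrow> is_embedding G \<Phi> \<and>
     (\<forall>C \<in> facial_walks G \<Phi>. is_cycle G C) \<and>
     (\<forall>C \<in> facial_walks G \<Phi>. \<forall>D \<in> facial_walks G \<Phi>. cycle_edges C \<noteq> cycle_edges D \<longrightarrow>
        set C \<inter> set D = {} \<or>
        (\<exists>v. set C \<inter> set D = {v}) \<or>
        (\<exists>u v. set C \<inter> set D = {u, v} \<and> cycle_edges C \<inter> cycle_edges D = {{u, v}}))"

definition facial_subwalk :: "'a pair_pre_digraph \<Rightarrow> 'a embedding \<Rightarrow> 'a list \<Rightarrow> bool" where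
  "facial_subwalk G \<Phi> p \<longleftrightarrow>
     (\<exists>C \<in> facial_walks G \<Phi>. \<exists>i. prefix p (rotate i C) \<or> prefix (rev p) (rotate i C))"

text \<open>
  A path and its reversal are the same path of the graph, so the scaffold multiset ranges over the
  classes {p, rev p}; each contributes one copy of the pair of its end vertices.
\<close>

definition facial_3paths :: "'a pair_pre_digraph \<Rightarrow> 'a embedding \<Rightarrow> 'a list set" where
  "facial_3paths G \<Phi> = {p. length p = 4 \<and> vpath p (with_proj G) \<and> facial_subwalk G \<Phi> p}"

definition scaffold_edges :: "'a pair_pre_digraph \<Rightarrow> 'a embedding \<Rightarrow> 'a set multiset" where
  "scaffold_edges G \<Phi> =
     image_mset (\<lambda>P. \<Union>p \<in> P. {hd p, last p}) (mset_set {{p, rev p} |p. p \<in> facial_3paths G \<Phi>})"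

record 'a extended_graph = "'a pair_pre_digraph" +
  scaffold :: "'a set multiset"

definition extended_graph :: "'a pair_pre_digraph \<Rightarrow> 'a embedding \<Rightarrow> 'a extended_graph" where
  "extended_graph G \<Phi> =
     \<lparr> pverts = pverts G, parcs = parcs G, scaffold = scaffold_edges G \<Phi> \<rparr>"

definition fork :: "'a extended_graph \<Rightarrow> 'a \<Rightarrow> 'a \<Rightarrow> 'a \<Rightarrow> 'a \<Rightarrow> 'a \<Rightarrow> bool" where
  "fork Ge a1 a2 a3 a4 a4' \<longleftrightarrow>
     distinct [a1, a2, a3, a4, a4'] \<and>
     {(a1, a2), (a2, a3), (a3, a4), (a3, a4')} \<subseteq> parcs Ge \<and>
     {a1, a4} \<in># scaffold Ge \<and> {a1, a4'} \<in># scaffold Ge"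

definition fork_solvable ::
    "'a pair_pre_digraph \<Rightarrow> 'a extended_graph \<Rightarrow> 'a \<Rightarrow> 'a \<Rightarrow> 'a \<Rightarrow> 'a \<Rightarrow> 'a \<Rightarrow> bool" where
  "fork_solvable G Ge a1 a2 a3 a4 a4' \<longleftrightarrow>
     (\<forall>\<Phi>'. polyhedral_embedding G \<Phi>' \<and> extended_graph G \<Phi>' = Ge \<longrightarrow>
        facial_subwalk G \<Phi>' [a1, a2, a3, a4]) \<or>
     (\<forall>\<Phi>'. polyhedral_embedding G \<Phi>' \<and> extended_graph G \<Phi>' = Ge \<longrightarrow>
        facial_subwalk G \<Phi>' [a1, a2, a3, a4'])"

definition butterfly_two ::
    "'a extended_graph \<Rightarrow> 'a \<Rightarrow> 'a \<Rightarrow> 'a \<Rightarrow> 'a \<Rightarrow> 'a \<Rightarrow> 'a \<Rightarrow> 'a \<Rightarrow> 'a \<Rightarrow> 'a \<Rightarrow> bool" where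
  "butterfly_two Ge t0 t0' t1 t2 t3 t4 t4' t5 t5' \<longleftrightarrow>
     distinct [t0, t0', t1, t2, t3, t4, t4', t5, t5'] \<and>
     is_cycle (pair_pre_digraph.truncate Ge) [t0, t1, t2, t3, t4, t5] \<and>
     is_cycle (pair_pre_digraph.truncate Ge) [t0', t1, t2, t3, t4', t5'] \<and>
     {t1, t4} \<in># scaffold Ge \<and> {t1, t4'} \<in># scaffold Ge \<and> {t0, t3} \<in># scaffold Ge"

text \<open>The Franklin graph, given by its LCF notation [5, -5]^6.\<close>

definition franklin_graph :: "nat pair_pre_digraph" where
  "franklin_graph =
     \<lparr> pverts = {..<12},
       parcs = {(u, v). u < 12 \<and> v < 12 \<and>
         (v = (u + 1) mod 12 \<or> u = (v + 1) mod 12 \<or>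
          even u \<and> v = (u + 5) mod 12 \<or> even v \<and> u = (v + 5) mod 12)} \<rparr>"

end

theory Submission
  imports Defs "HOL-Library.Product_Lexorder"
begin

text \<open>
  In a cubic graph a polyhedral embedding amounts to choosing, for each edge, how the corners at its
  two ends are paired off along the two sides. Since the disjunction of the fork cannot be solved,
  two embeddings with the same scaffold pair the corners along \<open>t2 t3\<close> differently. A facial path
  present in only one of them must be replaced in the other by a new facial path with the same ends.
  Every 4-cycle is facial in every embedding, so no edge of a 4-cycle changes its pairing; this
  leaves so few candidates for the replacement paths that each of them identifies a missing
  neighbour, until the twelve vertices found so far are closed under adjacency.
\<close>

section \<open>Face systems of cubic graphs\<close>

text \<open>Faces are handled as vertex sets, and a few local rules carry the argument: a face
  contains exactly two of the three neighbours of each of its vertices, and two faces coincide as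
  soon as they share three vertices or two nonadjacent ones. The obstacle is a lack of symmetry.
  Exchanging the two embeddings preserves the pattern around the path \<open>t1 t2 t3\<close>, but
  not the butterfly, since \<open>t5\<close> is joined to \<open>t0\<close> and \<open>t5'\<close>
  to \<open>t0'\<close>. So the early facts are obtained once and read for both embeddings, while
  the identification of the vertices treats them differently. The hypothesis on
  \<open>[t0' t3]\<close> makes both embeddings continue \<open>t3 t2 t1\<close> to the same vertex
  \<open>t0\<close>. The scaffold is read off one of the two embeddings, as both have the extended
  graph of the given one. Its faces are four hexagons and three squares; with 12 vertices and 18
  edges the Euler characteristic is 1, so the surface is the projective plane.\<close>

definition nb3 :: "('a \<Rightarrow> 'a \<Rightarrow> bool) \<Rightarrow> 'a \<Rightarrow> 'a \<Rightarrow> 'a \<Rightarrow> 'a \<Rightarrow> bool" where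
  "nb3 E v a b c \<longleftrightarrow> distinct [a, b, c] \<and> (\<forall>u. E v u \<longleftrightarrow> u = a \<or> u = b \<or> u = c)"

lemma nb3_swap: "nb3 E v a b c \<Longrightarrow> nb3 E v b a c" "nb3 E v a b c \<Longrightarrow> nb3 E v a c b"
  by (auto simp: nb3_def)

lemma nb3D:
  assumes "nb3 E v a b c"
  shows "E v a" "E v b" "E v c" "a \<noteq> b" "a \<noteq> c" "b \<noteq> c"
    and "\<And>u. E v u \<longleftrightarrow> u = a \<or> u = b \<or> u = c"
  using assms by (auto simp: nb3_def)

lemma nb3_complete:
  assumes "nb3 E v a b c" "E v d" "E v e" "d \<noteq> e"
  obtains f where "nb3 E v d e f"
proof -
  have "nb3 E v d e a \<or> nb3 E v d e b \<or> nb3 E v d e c"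
    using assms by (auto simp: nb3_def)
  then show thesis using that by blast
qed

text \<open>
  A polyhedral embedding of a cubic graph, seen through the vertex sets of its faces: a face is an
  induced cycle, so its vertex set determines it.
\<close>

locale face_system =
  fixes E :: "'a \<Rightarrow> 'a \<Rightarrow> bool" and \<F> :: "'a set set"
  assumes sym: "E u v \<Longrightarrow> E v u"
    and irrefl: "\<not> E v v"
    and corner: "E a b \<Longrightarrow> E b c \<Longrightarrow> a \<noteq> c \<Longrightarrow> \<exists>F\<in>\<F>. a \<in> F \<and> b \<in> F \<and> c \<in> F"
    and degree_two: "F \<in> \<F> \<Longrightarrow> v \<in> F \<Longrightarrow> \<exists>a b. a \<noteq> b \<and> {u \<in> F. E v u} = {a, b}"
    and share2: "F \<in> \<F> \<Longrightarrow> F' \<in> \<F> \<Longrightarrow> a \<in> F \<Longrightarrow> b \<in> F \<Longrightarrow> a \<in> F' \<Longrightarrow> b \<in> F' \<Longrightarrow>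
      a \<noteq> b \<Longrightarrow> \<not> E a b \<Longrightarrow> F = F'"
    and share3: "F \<in> \<F> \<Longrightarrow> F' \<in> \<F> \<Longrightarrow> a \<in> F \<Longrightarrow> b \<in> F \<Longrightarrow> c \<in> F \<Longrightarrow> a \<in> F' \<Longrightarrow> b \<in> F' \<Longrightarrow> c \<in> F' \<Longrightarrow>
      distinct [a, b, c] \<Longrightarrow> F = F'"
begin

text \<open>A face is an induced cycle, so a path of the graph with all its vertices on the face
  runs along it; the cyclic order need not be recorded.\<close>

definition fp :: "'a \<Rightarrow> 'a \<Rightarrow> 'a \<Rightarrow> 'a \<Rightarrow> bool" where
  "fp a b c d \<longleftrightarrow> distinct [a, b, c, d] \<and> E a b \<and> E b c \<and> E c d \<and> (\<exists>F\<in>\<F>. {a, b, c, d} \<subseteq> F)"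

text \<open>The local counting rule: two neighbours on a face exclude the third, and a missing
  neighbour forces the other two. Most vertices below are put on or off a face this way.\<close>

lemma face_nb3:
  assumes "nb3 E v a b c" "F \<in> \<F>" "v \<in> F"
  shows "(a \<in> F \<and> b \<in> F \<and> c \<notin> F) \<or> (a \<in> F \<and> b \<notin> F \<and> c \<in> F) \<or> (a \<notin> F \<and> b \<in> F \<and> c \<in> F)"
proof -
  obtain x y where xy: "x \<noteq> y" "{u \<in> F. E v u} = {x, y}"
    using degree_two assms(2,3) by blast
  have "{u \<in> F. E v u} = {a, b, c} \<inter> F"
    using assms(1) by (auto simp: nb3_def)
  with xy have eq: "{a, b, c} \<inter> F = {x, y}" by simp
  have d: "a \<noteq> b" "a \<noteq> c" "b \<noteq> c" using assms(1) by (auto simp: nb3_def)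
  have "card ({a, b, c} \<inter> F) = 2" using eq xy(1) by simp
  then show ?thesis using d by (auto simp: Int_insert_left split: if_splits)
qed

lemma fpI:
  assumes "F \<in> \<F>" "a \<in> F" "b \<in> F" "c \<in> F" "d \<in> F" "E a b" "E b c" "E c d" "distinct [a, b, c, d]"
  shows "fp a b c d"
  using assms unfolding fp_def by blast

lemma fpE:
  assumes "fp a b c d"
  obtains F where "F \<in> \<F>" "a \<in> F" "b \<in> F" "c \<in> F" "d \<in> F"
  using assms unfolding fp_def by blast

lemma fp_path: "fp a b c d \<Longrightarrow> distinct [a, b, c, d] \<and> E a b \<and> E b c \<and> E c d"
  unfolding fp_def by blast

lemma fp_face:
  assumes "fp a b c d" "F \<in> \<F>" "a \<in> F" "b \<in> F" "c \<in> F"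
  shows "d \<in> F"
proof -
  obtain F' where F': "F' \<in> \<F>" "a \<in> F'" "b \<in> F'" "c \<in> F'" "d \<in> F'" using assms(1) by (rule fpE)
  have "F' = F" using share3[OF F'(1) assms(2), of a b c] F' assms fp_path[OF assms(1)] by auto
  with F' show ?thesis by simp
qed

lemma fp_sym: "fp a b c d \<Longrightarrow> fp d c b a"
  unfolding fp_def using sym by auto

text \<open>The face at the corner \<open>a b c\<close> must leave \<open>c\<close> through
  \<open>d\<close> or through \<open>d'\<close>.\<close>

lemma fp_other_end:
  assumes "nb3 E b a a' c" "nb3 E c b d d'" "\<not> fp a b c d" "a \<noteq> d" "a \<noteq> d'"
  shows "fp a b c d'"
proof -
  have e: "E a b" "E b c" "a \<noteq> c" "a \<noteq> b" "b \<noteq> c" "E c d" "E c d'" "c \<noteq> d" "c \<noteq> d'"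
    using nb3D[OF assms(1)] nb3D[OF assms(2)] sym irrefl by metis+
  obtain F where F: "F \<in> \<F>" "a \<in> F" "b \<in> F" "c \<in> F" using corner[of a b c] e by blast
  have "d \<notin> F" using fpI[OF F, of d] F e assms(3,4) nb3D(4)[OF assms(2)] by auto
  then have "d' \<in> F" using face_nb3[OF assms(2) F(1,4)] by blast
  then show ?thesis using fpI[OF F, of d'] F e assms(5) nb3D(5)[OF assms(2)] by auto
qed

text \<open>The corners at \<open>b\<close> and at \<open>d\<close> both contain the nonadjacent
  vertices \<open>a\<close> and \<open>c\<close>, so a single face covers them.\<close>

lemma four_cycle_facial:
  assumes "E a b" "E b c" "E c d" "E d a" "a \<noteq> c" "b \<noteq> d" "\<not> E a c"
  shows "\<exists>F\<in>\<F>. {a, b, c, d} \<subseteq> F"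
proof -
  obtain F where F: "F \<in> \<F>" "a \<in> F" "b \<in> F" "c \<in> F" using corner[of a b c] assms by blast
  obtain F' where F': "F' \<in> \<F>" "c \<in> F'" "d \<in> F'" "a \<in> F'" using corner[of c d a] assms by blast
  have "F = F'" using share2[OF F(1) F'(1), of a c] F F' assms by blast
  then show ?thesis using F F' by blast
qed

end

section \<open>Pairs of face systems with equal scaffolds\<close>

text \<open>Equality of the scaffolds enters as exchange: if equally many facial paths join
  \<open>a\<close> and \<open>d\<close> in both systems, each path facial only in one is compensated
  by a path facial only in the other.\<close>

locale two_face_systems =
  S1: face_system E \<F>1 + S2: face_system E \<F>2
  for E :: "'a \<Rightarrow> 'a \<Rightarrow> bool" and \<F>1 \<F>2 +
  assumes cubic: "E v u \<Longrightarrow> \<exists>a b c. nb3 E v a b c"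
    and exchange12: "S1.fp a b c d \<Longrightarrow> \<not> S2.fp a b c d \<Longrightarrow> \<exists>b' c'. S2.fp a b' c' d \<and> \<not> S1.fp a b' c' d"
    and exchange21: "S2.fp a b c d \<Longrightarrow> \<not> S1.fp a b c d \<Longrightarrow> \<exists>b' c'. S1.fp a b' c' d \<and> \<not> S2.fp a b' c' d"
begin

lemma swap: "two_face_systems E \<F>2 \<F>1"
  using exchange12 exchange21 cubic
  by (intro two_face_systems.intro two_face_systems_axioms.intro
      S1.face_system_axioms S2.face_system_axioms) blast+

text \<open>Otherwise \<open>c\<close> is off \<open>F\<close>, so \<open>F\<close> leaves
  \<open>t0\<close> towards its third neighbour \<open>c''\<close>. The face at the corner
  \<open>z c t0\<close> then also turns to \<open>c''\<close>, shares \<open>z\<close>,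
  \<open>t0\<close>, \<open>c''\<close> with \<open>F\<close>, and would equal \<open>F\<close>.
  This serves to exclude replacement paths that start with the edge \<open>t1 t0\<close>.\<close>

lemma fp_transfer:
  assumes F: "F \<in> \<F>1" "t1 \<in> F" "t0 \<in> F" "z \<in> F" and f: "S2.fp t1 t0 c z"
  shows "S1.fp t1 t0 c z"
proof (rule ccontr)
  assume n: "\<not> S1.fp t1 t0 c z"
  have p: "distinct [t1, t0, c, z]" "E t1 t0" "E t0 c" "E c z" using S2.fp_path[OF f] by auto
  obtain D where D: "D \<in> \<F>2" "t1 \<in> D" "t0 \<in> D" "c \<in> D" "z \<in> D" using f by (rule S2.fpE)
  obtain c'' where N: "nb3 E t0 t1 c c''"
    by (metis cubic nb3_complete p S1.sym distinct_length_2_or_more)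
  obtain z' where N': "nb3 E c t0 z z'"
    by (metis cubic nb3_complete p S1.sym distinct_length_2_or_more)
  \<comment> \<open>An edge \<open>t0 z\<close> would put all three neighbours of \<open>t0\<close>
    on \<open>D\<close>.\<close>
  have "\<not> E t0 z"
  proof
    assume "E t0 z"
    then have "z = c''" using nb3D(7)[OF N] p by auto
    then show False using S2.face_nb3[OF N D(1,3)] D by blast
  qed
  then have zc'': "z \<noteq> c''" using nb3D(3)[OF N] by auto
  have cF: "c \<notin> F" using S1.fpI[OF F(1), of t1 t0 c z] F p n by auto
  then have c''F: "c'' \<in> F" using S1.face_nb3[OF N F(1,3)] by blast
  have "S1.fp z c t0 c''"
  proof (rule S1.fp_other_end)
    show "nb3 E c z z' t0" using N' by (auto simp: nb3_def)
    show "nb3 E t0 c t1 c''" using N by (auto simp: nb3_def)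
    show "\<not> S1.fp z c t0 t1" using n S1.fp_sym by blast
  qed (use p zc'' in auto)
  then obtain F' where F': "F' \<in> \<F>1" "z \<in> F'" "c \<in> F'" "t0 \<in> F'" "c'' \<in> F'" by (rule S1.fpE)
  have "F' = F" using S1.share3[OF F'(1) F(1), of z t0 c''] F F' c''F zc'' p nb3D[OF N] S1.irrefl by auto
  then show False using F' cF by simp
qed

end

section \<open>Two embeddings that differ along an edge\<close>

text \<open>
  The face entering along \<open>t0, t1, t2, t3\<close> leaves \<open>t3\<close> towards \<open>z'\<close> in the first system and
  towards \<open>z\<close> in the second; exchanging the systems exchanges \<open>z\<close> and \<open>z'\<close>.
\<close>

locale prong = two_face_systems +
  fixes t0 t1 t2 t3 z z' p0 x2 :: 'a
  assumes dist: "distinct [t0, t1, t2, t3, z, z', p0]"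
    and nt1: "nb3 E t1 t0 t2 p0"
    and nt2: "nb3 E t2 t1 t3 x2"
    and nt3: "nb3 E t3 t2 z z'"
    and bent1: "S1.fp t1 t2 t3 z'"
    and bent2: "S2.fp t1 t2 t3 z"
    and ends1: "S1.fp t0 t1 t2 t3"
    and ends2: "S2.fp t0 t1 t2 t3"
begin

lemma swap_prong: "prong E \<F>2 \<F>1 t0 t1 t2 t3 z' z p0 x2"
proof -
  have "nb3 E t3 t2 z' z" using nt3 by (rule nb3_swap)
  then show ?thesis
    using dist nt1 nt2 bent1 bent2 ends1 ends2 swap
    by (intro prong.intro prong_axioms.intro) auto
qed

lemma face_A2: obtains A where "A \<in> \<F>2" "t0 \<in> A" "t1 \<in> A" "t2 \<in> A" "t3 \<in> A" "z \<in> A" "z' \<notin> A" "x2 \<notin> A"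
proof -
  obtain A where A: "A \<in> \<F>2" "t1 \<in> A" "t2 \<in> A" "t3 \<in> A" "z \<in> A"
    using bent2 by (rule S2.fpE)
  moreover have "t0 \<in> A" using S2.fp_face[OF S2.fp_sym[OF ends2] A(1)] A by blast
  moreover have "z' \<notin> A" using S2.face_nb3[OF nt3 A(1,4)] A by blast
  moreover have "x2 \<notin> A" using S2.face_nb3[OF nt2 A(1,3)] A by blast
  ultimately show thesis using that by blast
qed

lemma face_A1: obtains A where "A \<in> \<F>1" "t0 \<in> A" "t1 \<in> A" "t2 \<in> A" "t3 \<in> A" "z' \<in> A" "z \<notin> A" "x2 \<notin> A"
  using prong.face_A2[OF swap_prong] by blast

lemma edges: "E t1 t0" "E t0 t1" "E t1 t2" "E t2 t1" "E t2 t3" "E t3 t2" "E t3 z" "E z t3" "E t1 p0" "E p0 t1" "E t2 x2" "E x2 t2"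
  using nb3D[OF nt1] nb3D[OF nt2] nb3D[OF nt3] S1.sym by blast+

lemma x2_neq: "x2 \<noteq> t1" "x2 \<noteq> t2" "x2 \<noteq> t3" "x2 \<noteq> z" "x2 \<noteq> t0"
proof -
  show "x2 \<noteq> t1" "x2 \<noteq> t3" using nb3D[OF nt2] by auto
  show "x2 \<noteq> t2" using edges S1.irrefl by metis
  show "x2 \<noteq> z" "x2 \<noteq> t0" using face_A2 by metis+
qed

lemma nonadj: "\<not> E t2 z" "\<not> E t1 z"
  using nb3D(7)[OF nt2] nb3D(7)[OF nt1] dist x2_neq by auto

text \<open>Otherwise \<open>t2 t3 z x2\<close> is a 4-cycle, hence facial in the second system;
  sharing \<open>t2\<close>, \<open>t3\<close>, \<open>z\<close> with \<open>A\<close> it would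
  equal \<open>A\<close>, which misses \<open>x2\<close>.\<close>

lemma x2_nonadj: "\<not> E x2 z"
proof
  assume e: "E x2 z"
  obtain F where F: "F \<in> \<F>2" "{t2, t3, z, x2} \<subseteq> F"
    using S2.four_cycle_facial[of t2 t3 z x2] e edges S1.sym dist x2_neq nonadj by auto
  obtain A where A: "A \<in> \<F>2" "t0 \<in> A" "t1 \<in> A" "t2 \<in> A" "t3 \<in> A" "z \<in> A" "z' \<notin> A" "x2 \<notin> A"
    by (rule face_A2)
  have "F = A" using S2.share3[OF F(1) A(1), of t2 t3 z] F A dist by auto
  then show False using F A by blast
qed

lemma not_bent1: "\<not> S1.fp t1 t2 t3 z"
proof
  assume f: "S1.fp t1 t2 t3 z"
  obtain A where A: "A \<in> \<F>1" "t0 \<in> A" "t1 \<in> A" "t2 \<in> A" "t3 \<in> A" "z' \<in> A" "z \<notin> A" "x2 \<notin> A"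
    by (rule face_A1)
  show False using S1.fp_face[OF f A(1)] A by blast
qed

text \<open>The other side of the edge \<open>t2 t3\<close>: in the first system one face joins
  \<open>t1\<close> to \<open>z'\<close> along it, so the opposite one joins \<open>x2\<close> to
  \<open>z\<close>.\<close>

lemma face_B1: obtains B where "B \<in> \<F>1" "x2 \<in> B" "t2 \<in> B" "t3 \<in> B" "z \<in> B" "t1 \<notin> B"
proof -
  obtain B where B: "B \<in> \<F>1" "x2 \<in> B" "t2 \<in> B" "t3 \<in> B"
    using S1.corner[of x2 t2 t3] edges x2_neq by auto
  obtain A where A: "A \<in> \<F>1" "t0 \<in> A" "t1 \<in> A" "t2 \<in> A" "t3 \<in> A" "z' \<in> A" "z \<notin> A" "x2 \<notin> A"
    by (rule face_A1)
  have t1: "t1 \<notin> B" using S1.face_nb3[OF nt2 B(1,3)] B by blast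
  have "z' \<notin> B" using S1.share3[OF B(1) A(1), of t2 t3 z'] A B dist by auto
  then have "z \<in> B" using S1.face_nb3[OF nt3 B(1,4)] B by blast
  with B t1 show thesis using that by blast
qed

text \<open>The path \<open>t1 t2 t3 z\<close> is facial only in the second system; of the three
  possible starts of its replacement only \<open>p0\<close> survives.\<close>

lemma gain_raw: "\<exists>b. S1.fp t1 p0 b z \<and> \<not> S2.fp t1 p0 b z"
proof -
  obtain u v where uv: "S1.fp t1 u v z" "\<not> S2.fp t1 u v z"
    using exchange21[OF bent2 not_bent1] by blast
  have p: "distinct [t1, u, v, z]" "E t1 u" "E u v" "E v z" using S1.fp_path[OF uv(1)] by auto
  \<comment> \<open>\<open>A\<close> contains \<open>t1\<close>, \<open>t0\<close> and
    \<open>z\<close>, so a path \<open>t1 t0 v z\<close> facial in the first system would be facial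
    in the second as well.\<close>
  have "u \<noteq> t0"
  proof
    assume "u = t0"
    obtain A where A: "A \<in> \<F>2" "t0 \<in> A" "t1 \<in> A" "t2 \<in> A" "t3 \<in> A" "z \<in> A" "z' \<notin> A" "x2 \<notin> A"
      by (rule face_A2)
    show False using two_face_systems.fp_transfer[OF swap A(1,3,2,6)] uv \<open>u = t0\<close> by blast
  qed
  \<comment> \<open>From \<open>t2\<close> the path could go on to \<open>t3\<close>, which is the
    lost path itself, or to \<open>x2\<close>, which is not adjacent to \<open>z\<close>.\<close>
  moreover have "u \<noteq> t2"
    using p uv(1) not_bent1 x2_nonadj nb3D(7)[OF nt2] by auto
  ultimately have "u = p0" using p nb3D(7)[OF nt1] by auto
  then show ?thesis using uv by blast
qed

text \<open>If they were equal, the face of the replacement path and the face \<open>B\<close> would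
  share the nonadjacent vertices \<open>x2\<close> and \<open>z\<close>, yet only the former
  contains \<open>t1\<close>.\<close>

lemma x2_neq_p0: "x2 \<noteq> p0"
proof
  assume e: "x2 = p0"
  obtain b where b: "S1.fp t1 p0 b z" using gain_raw by blast
  have p: "distinct [t1, p0, b, z]" "E p0 b" "E b z" using S1.fp_path[OF b] by auto
  obtain P where P: "P \<in> \<F>1" "t1 \<in> P" "p0 \<in> P" "b \<in> P" "z \<in> P" using b by (rule S1.fpE)
  obtain B where B: "B \<in> \<F>1" "x2 \<in> B" "t2 \<in> B" "t3 \<in> B" "z \<in> B" "t1 \<notin> B" by (rule face_B1)
  have "P = B" using S1.share2[OF P(1) B(1), of p0 z] P B e x2_nonadj dist by auto
  then show False using P B by blast
qed

text \<open>The face of the replacement path misses \<open>t2\<close>, since \<open>t2\<close> and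
  \<open>z\<close> are nonadjacent and lie together on \<open>B\<close>, which misses
  \<open>t1\<close>. Hence it passes \<open>t1\<close> between \<open>p0\<close> and
  \<open>t0\<close>.\<close>

lemma gain:
  obtains b P where "S1.fp t1 p0 b z" "\<not> S2.fp t1 p0 b z"
    "P \<in> \<F>1" "t0 \<in> P" "t1 \<in> P" "p0 \<in> P" "b \<in> P" "z \<in> P" "t2 \<notin> P" "t3 \<notin> P"
proof -
  obtain b where b: "S1.fp t1 p0 b z" "\<not> S2.fp t1 p0 b z" using gain_raw by blast
  obtain P where P: "P \<in> \<F>1" "t1 \<in> P" "p0 \<in> P" "b \<in> P" "z \<in> P" using b(1) by (rule S1.fpE)
  obtain B where B: "B \<in> \<F>1" "x2 \<in> B" "t2 \<in> B" "t3 \<in> B" "z \<in> B" "t1 \<notin> B" by (rule face_B1)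
  obtain A where A: "A \<in> \<F>1" "t0 \<in> A" "t1 \<in> A" "t2 \<in> A" "t3 \<in> A" "z' \<in> A" "z \<notin> A" "x2 \<notin> A"
    by (rule face_A1)
  have t2: "t2 \<notin> P"
  proof
    assume "t2 \<in> P"
    have "P = B" using S1.share2[OF P(1) B(1), of t2 z] P B \<open>t2 \<in> P\<close> nonadj dist by auto
    then show False using P B by blast
  qed
  then have t0: "t0 \<in> P" using S1.face_nb3[OF nt1 P(1,2)] by blast
  have t3: "t3 \<notin> P"
  proof
    assume "t3 \<in> P"
    have "P = A" using S1.share3[OF P(1) A(1), of t0 t1 t3] P A t0 \<open>t3 \<in> P\<close> dist by auto
    then show False using P A by blast
  qed
  show thesis by (rule that[OF b P(1) t0 P(2-5) t2 t3])
qed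

text \<open>The other side of the edge \<open>t1 t2\<close>: one face joins \<open>t0\<close> to
  \<open>t3\<close> along it, so the opposite one joins \<open>p0\<close> to
  \<open>x2\<close>.\<close>

lemma opposite_corner: 
  "\<exists>D\<in>\<F>1. {x2, t2, t1, p0} \<subseteq> D \<and> t0 \<notin> D"
proof -
  obtain D where D: "D \<in> \<F>1" "t2 \<in> D" "t1 \<in> D" "p0 \<in> D"
    using S1.corner[of t2 t1 p0] edges dist by auto
  obtain A where A: "A \<in> \<F>1" "t0 \<in> A" "t1 \<in> A" "t2 \<in> A" "t3 \<in> A" "z' \<in> A" "z \<notin> A" "x2 \<notin> A"
    by (rule face_A1)
  have t0: "t0 \<notin> D" using S1.face_nb3[OF nt1 D(1,3)] D by blast
  have "t3 \<notin> D" using S1.share3[OF D(1) A(1), of t1 t2 t3] A D t0 dist by auto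
  then have "x2 \<in> D" using S1.face_nb3[OF nt2 D(1,2)] by blast
  then show ?thesis using D t0 by blast
qed

end

section \<open>The butterfly and its unknown third neighbours\<close>

text \<open>\<open>p0\<close>, \<open>p4\<close>, \<open>p5\<close> stand for \<open>t0'\<close>,
  \<open>t4'\<close>, \<open>t5'\<close>; the \<open>x\<close> and \<open>w\<close> parameters are
  third neighbours still to be identified. Only the underlying prong survives an exchange of the
  systems, with \<open>t4\<close> and \<open>p4\<close> exchanged as well.\<close>

locale butterfly = prong E \<F>1 \<F>2 t0 t1 t2 t3 t4 p4 p0 x2
  for E :: "'a \<Rightarrow> 'a \<Rightarrow> bool" and \<F>1 \<F>2 t0 t1 t2 t3 t4 p4 p0 x2 +
  fixes t5 p5 x0 x4 x5 w0 w4 w5 :: 'a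
  assumes distinct9: "distinct [t0, t1, t2, t3, t4, t5, p0, p4, p5]"
    and nt0: "nb3 E t0 t1 t5 x0"
    and nt4: "nb3 E t4 t3 t5 x4"
    and nt5: "nb3 E t5 t0 t4 x5"
    and np0: "nb3 E p0 t1 p5 w0"
    and np4: "nb3 E p4 t3 p5 w4"
    and np5: "nb3 E p5 p0 p4 w5"
begin

lemma edges9: "E t4 t5" "E t5 t4" "E t5 t0" "E t0 t5" "E t3 p4" "E p4 t3" "E p0 p5" "E p5 p0" "E p4 p5" "E p5 p4"
  "E t0 x0" "E x0 t0" "E t4 x4" "E x4 t4" "E t5 x5" "E x5 t5" "E p0 w0" "E w0 p0" "E p4 w4" "E w4 p4"
  "E p5 w5" "E w5 p5"
  using nb3D(1-3)[OF nt0] nb3D(1-3)[OF nt3] nb3D(1-3)[OF nt4] nb3D(1-3)[OF nt5]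
    nb3D(1-3)[OF np0] nb3D(1-3)[OF np4] nb3D(1-3)[OF np5] S1.sym by blast+

lemma neqs: "t0 \<noteq> t1" "t0 \<noteq> t2" "t0 \<noteq> t3" "t0 \<noteq> t4" "t0 \<noteq> t5" "t0 \<noteq> p0" "t0 \<noteq> p4" "t0 \<noteq> p5"
  "t1 \<noteq> t2" "t1 \<noteq> t3" "t1 \<noteq> t4" "t1 \<noteq> t5" "t1 \<noteq> p0" "t1 \<noteq> p4" "t1 \<noteq> p5"
  "t2 \<noteq> t3" "t2 \<noteq> t4" "t2 \<noteq> t5" "t2 \<noteq> p0" "t2 \<noteq> p4" "t2 \<noteq> p5"
  "t3 \<noteq> t4" "t3 \<noteq> t5" "t3 \<noteq> p0" "t3 \<noteq> p4" "t3 \<noteq> p5"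
  "t4 \<noteq> t5" "t4 \<noteq> p0" "t4 \<noteq> p4" "t4 \<noteq> p5" "t5 \<noteq> p0" "t5 \<noteq> p4" "t5 \<noteq> p5"
  "p0 \<noteq> p4" "p0 \<noteq> p5" "p4 \<noteq> p5"
  "x0 \<noteq> t1" "x0 \<noteq> t5" "x2 \<noteq> t1" "x2 \<noteq> t3" "x4 \<noteq> t3" "x4 \<noteq> t5" "x5 \<noteq> t0" "x5 \<noteq> t4"
  "w0 \<noteq> t1" "w0 \<noteq> p5" "w4 \<noteq> t3" "w4 \<noteq> p5" "w5 \<noteq> p0" "w5 \<noteq> p4"
  using distinct9 nb3D(4-6)[OF nt0] nb3D(4-6)[OF nt2] nb3D(4-6)[OF nt4] nb3D(4-6)[OF nt5]
    nb3D(4-6)[OF np0] nb3D(4-6)[OF np4] nb3D(4-6)[OF np5] by auto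

lemmas neqs' = neqs neqs[symmetric]

lemma x2_nonadj': "\<not> E x2 t4" "\<not> E x2 p4" "\<not> E t4 x2" "\<not> E p4 x2"
  using x2_nonadj prong.x2_nonadj[OF swap_prong] S1.sym by blast+

lemma x2_neqs: "x2 \<noteq> t0" "x2 \<noteq> t1" "x2 \<noteq> t2" "x2 \<noteq> t3" "x2 \<noteq> t4" "x2 \<noteq> t5" "x2 \<noteq> p0" "x2 \<noteq> p4" "x2 \<noteq> p5"
  using x2_neq prong.x2_neq(4)[OF swap_prong] x2_neq_p0 x2_nonadj' edges9 by metis+

text \<open>The vertex of the gained path next to \<open>t4\<close> cannot be \<open>t5\<close>:
  then \<open>x5\<close> would be \<open>p0\<close>, and all three neighbours of \<open>t5\<close>
  would lie on \<open>P\<close>. So it is \<open>x4\<close>, which thereby becomes a neighbour of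
  \<open>p0\<close>.\<close>

lemma P_face:
  obtains P where "P \<in> \<F>1" "t0 \<in> P" "t1 \<in> P" "p0 \<in> P" "x4 \<in> P" "t4 \<in> P" "t5 \<in> P" "t2 \<notin> P" "t3 \<notin> P"
    "S1.fp t1 p0 x4 t4" "\<not> S2.fp t1 p0 x4 t4"
proof -
  obtain b P where b: "S1.fp t1 p0 b t4" "\<not> S2.fp t1 p0 b t4"
    and P: "P \<in> \<F>1" "t0 \<in> P" "t1 \<in> P" "p0 \<in> P" "b \<in> P" "t4 \<in> P" "t2 \<notin> P" "t3 \<notin> P"
    by (rule gain)
  have e: "E p0 b" "E b t4" "E t4 b" "E b p0" using S1.fp_path[OF b(1)] S1.sym by blast+
  have "b \<noteq> t3" using P by blast
  moreover have "b \<noteq> t5"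
  proof
    assume "b = t5"
    then have "x5 = p0" using e nb3D(7)[OF nt5] neqs' by metis
    then show False using S1.face_nb3[OF nt5 P(1)] P \<open>b = t5\<close> by blast
  qed
  ultimately have bx: "b = x4" using e nb3D(7)[OF nt4] by blast
  have "t5 \<in> P" using S1.face_nb3[OF nt4 P(1)] P by blast
  then show thesis using that P b bx by blast
qed

lemma x4_adj: "E p0 x4" "E x4 p0" "x4 \<noteq> t0" "x4 \<noteq> t1" "x4 \<noteq> p0"
proof -
  obtain P where "S1.fp t1 p0 x4 t4" by (rule P_face)
  then show e: "E p0 x4" "E x4 p0" "x4 \<noteq> t1" "x4 \<noteq> p0" using S1.fp_path S1.sym by auto
  show "x4 \<noteq> t0"
  proof
    assume "x4 = t0"
    then have "x0 = t4" "x0 = p0" using e edges9 nb3D(7)[OF nt0] neqs' by metis+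
    then show False using neqs by simp
  qed
qed

lemma t0_t4: "\<not> E t0 t4" "\<not> E t4 t0"
  using nb3D(7)[OF nt4] x4_adj neqs S1.sym by metis+

text \<open>As \<open>t0\<close> and \<open>t4\<close> are nonadjacent, the corner at
  \<open>t5\<close> belongs to the face of the prong. So in the second system that face is the whole
  6-cycle, and it misses every third neighbour.\<close>

lemma A2_face:
  obtains A where "A \<in> \<F>2" "t0 \<in> A" "t1 \<in> A" "t2 \<in> A" "t3 \<in> A" "t4 \<in> A" "t5 \<in> A"
    "p4 \<notin> A" "x2 \<notin> A" "x0 \<notin> A" "x4 \<notin> A" "x5 \<notin> A"
proof -
  obtain A where A: "A \<in> \<F>2" "t0 \<in> A" "t1 \<in> A" "t2 \<in> A" "t3 \<in> A" "t4 \<in> A" "p4 \<notin> A" "x2 \<notin> A"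
    by (rule face_A2)
  obtain F where F: "F \<in> \<F>2" "t0 \<in> F" "t5 \<in> F" "t4 \<in> F"
    using S2.corner[of t0 t5 t4] edges9 neqs by auto
  have "F = A" using S2.share2[OF F(1) A(1), of t0 t4] F A t0_t4 neqs by auto
  then have "t5 \<in> A" using F by simp
  then show thesis
    using that[OF A(1-6) _ A(7,8)] S2.face_nb3[OF nt0 A(1,2)] S2.face_nb3[OF nt4 A(1,6)]
      S2.face_nb3[OF nt5 A(1)] A by blast
qed

text \<open>The gain of the exchanged prong. If its path avoided \<open>p5\<close>, then
  \<open>p0 p5 p4 b\<close> would be a facial 4-cycle equal to \<open>P\<close>, and all three
  neighbours of \<open>p0\<close> would lie on it.\<close>

lemma P2_face:
  obtains P where "P \<in> \<F>2" "t0 \<in> P" "t1 \<in> P" "p0 \<in> P" "p5 \<in> P" "p4 \<in> P" "t2 \<notin> P" "t3 \<notin> P"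
proof -
  obtain b P where b: "S2.fp t1 p0 b p4" "\<not> S1.fp t1 p0 b p4"
    and P: "P \<in> \<F>2" "t0 \<in> P" "t1 \<in> P" "p0 \<in> P" "b \<in> P" "p4 \<in> P" "t2 \<notin> P" "t3 \<notin> P"
    by (rule prong.gain[OF swap_prong])
  have e: "E p0 b" "E b p4" "E p4 b" "E b p0" "distinct [t1, p0, b, p4]"
    using S2.fp_path[OF b(1)] S1.sym by blast+
  have "b = p5"
  proof (rule ccontr)
    assume n: "b \<noteq> p5"
    then have bw: "b = w0" using e nb3D(7)[OF np0] by auto
    have na: "\<not> E p0 p4" using nb3D(7)[OF np0] e bw neqs' by auto
    obtain F where F: "F \<in> \<F>2" "{p0, p5, p4, b} \<subseteq> F"
      using S2.four_cycle_facial[of p0 p5 p4 b] e edges9 n na neqs' by auto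
    have "F = P" using S2.share3[OF F(1) P(1), of p0 b p4] F P e by auto
    then show False using S2.face_nb3[OF np0 P(1,4)] P F bw by blast
  qed
  then show thesis using that P by blast
qed

lemma Q2_face:
  obtains Q where "Q \<in> \<F>2" "x2 \<in> Q" "t2 \<in> Q" "t1 \<in> Q" "p0 \<in> Q" "w0 \<in> Q" "t0 \<notin> Q" "p5 \<notin> Q"
proof -
  obtain Q where Q: "Q \<in> \<F>2" "{x2, t2, t1, p0} \<subseteq> Q" "t0 \<notin> Q"
    using prong.opposite_corner[OF swap_prong] by blast
  obtain P where P: "P \<in> \<F>2" "t0 \<in> P" "t1 \<in> P" "p0 \<in> P" "p5 \<in> P" "p4 \<in> P" "t2 \<notin> P" "t3 \<notin> P"
    by (rule P2_face)
  have p5: "p5 \<notin> Q" using S2.share3[OF Q(1) P(1), of t1 p0 p5] Q P neqs by auto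
  then have "w0 \<in> Q" using S2.face_nb3[OF np0 Q(1)] Q by blast
  then show thesis using that Q p5 by blast
qed

text \<open>What replaces the path \<open>x2, t2, t3, t4\<close> in the second embedding.\<close>

lemma gain_x2_t4:
  obtains u v D where "S2.fp x2 u v t4" "D \<in> \<F>2" "x2 \<in> D" "u \<in> D" "v \<in> D" "t4 \<in> D"
    "(v = x4 \<and> E x4 u) \<or> (v = t5 \<and> u = x5 \<and> t3 \<notin> D \<and> x4 \<in> D)"
proof -
  obtain B where B: "B \<in> \<F>1" "x2 \<in> B" "t2 \<in> B" "t3 \<in> B" "t4 \<in> B" "t1 \<notin> B" by (rule face_B1)
  obtain A where A: "A \<in> \<F>2" "t0 \<in> A" "t1 \<in> A" "t2 \<in> A" "t3 \<in> A" "t4 \<in> A" "t5 \<in> A"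
    "p4 \<notin> A" "x2 \<notin> A" "x0 \<notin> A" "x4 \<notin> A" "x5 \<notin> A" by (rule A2_face)
  have f1: "S1.fp x2 t2 t3 t4" using S1.fpI[OF B(1-5)] edges x2_neqs neqs by auto
  have f2: "\<not> S2.fp x2 t2 t3 t4" using S2.fp_face[OF S2.fp_sym A(1)] A by blast
  obtain u v where uv: "S2.fp x2 u v t4" "\<not> S1.fp x2 u v t4" using exchange12[OF f1 f2] by blast
  obtain D where D: "D \<in> \<F>2" "x2 \<in> D" "u \<in> D" "v \<in> D" "t4 \<in> D" using uv(1) by (rule S2.fpE)
  have p: "distinct [x2, u, v, t4]" "E x2 u" "E u v" "E v t4" "E t4 v" "E v u" "E u x2"
    using S2.fp_path[OF uv(1)] S1.sym by auto
  \<comment> \<open>Before \<open>t3\<close> comes either \<open>t2\<close>, which gives the lost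
    path, or \<open>p4\<close>, which is not adjacent to \<open>x2\<close>.\<close>
  have "v \<noteq> t3" using p f2 uv x2_nonadj' nb3D(7)[OF nt3] by auto
  then consider "v = x4" | "v = t5" using p nb3D(7)[OF nt4] by blast
  then show thesis
  proof cases
    case 1
    then show thesis using that[OF uv(1) D] p by blast
  next
    case 2
    have "u \<noteq> t0" using S2.share3[OF D(1) A(1), of t0 t5 t4] 2 D A neqs by auto
    then have u: "u = x5" using 2 p nb3D(7)[OF nt5] by auto
    have t3: "t3 \<notin> D" using S2.share3[OF D(1) A(1), of t3 t5 t4] 2 D A neqs by auto
    then have "x4 \<in> D" using S2.face_nb3[OF nt4 D(1,5)] by blast
    then show thesis using that[OF uv(1) D] 2 u t3 by blast
  qed
qed

text \<open>Otherwise \<open>x4\<close> is the third neighbour of \<open>p0\<close>. No face of the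
  second system contains \<open>t1\<close>, \<open>p0\<close>, \<open>x4\<close> and
  \<open>t4\<close>, so \<open>Q\<close> turns at \<open>x4\<close> away from \<open>t4\<close>. But
  either replacement of \<open>x2 t2 t3 t4\<close> yields a face through \<open>t4\<close> that
  shares three vertices with \<open>Q\<close>.\<close>

lemma x4_eq: "x4 = p5"
proof (rule ccontr)
  assume n: "x4 \<noteq> p5"
  have w0: "w0 = x4" using x4_adj n nb3D(7)[OF np0] by auto
  have nf: "\<not> S2.fp t1 p0 x4 t4" using P_face by blast
  obtain c where nb: "nb3 E x4 p0 t4 c"
    using cubic nb3_complete x4_adj(2) edges9 neqs' by metis
  obtain P where P: "P \<in> \<F>2" "t0 \<in> P" "t1 \<in> P" "p0 \<in> P" "p5 \<in> P" "p4 \<in> P" "t2 \<notin> P" "t3 \<notin> P"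
    by (rule P2_face)
  obtain Q where Q: "Q \<in> \<F>2" "x2 \<in> Q" "t2 \<in> Q" "t1 \<in> Q" "p0 \<in> Q" "w0 \<in> Q" "t0 \<notin> Q" "p5 \<notin> Q"
    by (rule Q2_face)
  obtain A where A: "A \<in> \<F>2" "t0 \<in> A" "t1 \<in> A" "t2 \<in> A" "t3 \<in> A" "t4 \<in> A" "t5 \<in> A"
    "p4 \<notin> A" "x2 \<notin> A" "x0 \<notin> A" "x4 \<notin> A" "x5 \<notin> A" by (rule A2_face)
  have joined: "\<not> (t1 \<in> F \<and> p0 \<in> F \<and> x4 \<in> F \<and> t4 \<in> F)" if "F \<in> \<F>2" for F
    using S2.fpI[OF that, of t1 p0 x4 t4] nf x4_adj edges edges9 neqs' S1.irrefl by auto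
  have t4Q: "t4 \<notin> Q" using joined[OF Q(1)] Q w0 by blast
  then have cQ: "c \<in> Q" using S2.face_nb3[OF nb Q(1)] Q w0 by blast
  have x2x4: "x2 \<noteq> x4" using x2_nonadj' edges9 by auto
  obtain u v D where f: "S2.fp x2 u v t4" and D: "D \<in> \<F>2" "x2 \<in> D" "u \<in> D" "v \<in> D" "t4 \<in> D"
    and c: "(v = x4 \<and> E x4 u) \<or> (v = t5 \<and> u = x5 \<and> t3 \<notin> D \<and> x4 \<in> D)"
    by (rule gain_x2_t4)
  have p: "distinct [x2, u, v, t4]" "E x2 u" "E u v" "E v t4" "E u x2"
    using S2.fp_path[OF f] S1.sym by auto
  from c show False
  proof
    assume 1: "v = x4 \<and> E x4 u"
    have "u \<noteq> p0" using p 1 w0 x2_neqs nb3D(7)[OF np0] by auto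
    then have "u = c" using 1 p nb3D(7)[OF nb] by auto
    then have "D = Q" using S2.share3[OF D(1) Q(1), of x2 c x4] p 1 D Q w0 cQ by auto
    then show False using D t4Q by blast
  next
    assume 2: "v = t5 \<and> u = x5 \<and> t3 \<notin> D \<and> x4 \<in> D"
    obtain H where H: "H \<in> \<F>2" "t4 \<in> H" "x4 \<in> H" "p0 \<in> H"
      using S2.corner[of t4 x4 p0] edges9 x4_adj neqs' by auto
    have t1: "t1 \<notin> H" using joined[OF H(1)] H by blast
    then have p5: "p5 \<in> H" using S2.face_nb3[OF np0 H(1,4)] by blast
    \<comment> \<open>If \<open>H\<close> turned at \<open>t4\<close> to \<open>t3\<close>, it would
      go on to \<open>p4\<close> and equal \<open>P\<close>, which contains
      \<open>t1\<close>.\<close>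
    have t5: "t5 \<in> H"
    proof (rule ccontr)
      assume "t5 \<notin> H"
      then have t3: "t3 \<in> H" using S2.face_nb3[OF nt4 H(1,2)] by blast
      have "t2 \<notin> H" using S2.share3[OF H(1) A(1), of t2 t3 t4] H t3 A \<open>t5 \<notin> H\<close> neqs by auto
      then have "p4 \<in> H" using S2.face_nb3[OF nt3 H(1) t3] by blast
      then have "H = P" using S2.share3[OF H(1) P(1), of p0 p5 p4] H P p5 neqs by auto
      then show False using P t1 by blast
    qed
    have "H = D" using S2.share3[OF H(1) D(1), of t5 t4 x4] H D 2 t5 neqs' edges9 S1.irrefl by auto
    then have "H = Q" using S2.share3[OF H(1) Q(1), of x2 p0 x4] H D Q w0 x2x4 x2_neqs x4_adj by auto
    then show False using H t4Q by blast
  qed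
qed

end

section \<open>Closing the graph at twelve vertices\<close>

context butterfly
begin

lemma np5': "nb3 E p5 p0 p4 t4"
proof -
  have "w5 = t4" using x4_eq edges9 nb3D(7)[OF np5] neqs' by metis
  then show ?thesis using np5 by simp
qed

lemma t4_p5: "E t4 p5" "E p5 t4" using nb3D(3)[OF np5'] S1.sym by blast+

lemma nt4': "nb3 E t4 t3 t5 p5" using nt4 x4_eq by simp

lemma t3_p5: "\<not> E t3 p5" using nb3D(7)[OF nt3] neqs' by simp

lemma square_face2: obtains F where "F \<in> \<F>2" "t3 \<in> F" "t4 \<in> F" "p5 \<in> F" "p4 \<in> F"
  using S2.four_cycle_facial[of t3 t4 p5 p4] t3_p5 t4_p5 edges edges9 neqs' by auto

text \<open>If the replacement of \<open>x2 t2 t3 t4\<close> ends in \<open>p5 t4\<close>, its inner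
  vertex \<open>p0\<close> is adjacent to \<open>x2\<close>, as wanted. If it ends in
  \<open>t5 t4\<close>, its face is forced from \<open>p5\<close> through \<open>p0\<close> to
  \<open>w0\<close>; were \<open>w0\<close> not \<open>x2\<close>, it would equal \<open>Q\<close>,
  which misses \<open>p5\<close>.\<close>

lemma w0_eq: "w0 = x2"
proof (rule ccontr)
  assume n: "w0 \<noteq> x2"
  obtain P where P: "P \<in> \<F>2" "t0 \<in> P" "t1 \<in> P" "p0 \<in> P" "p5 \<in> P" "p4 \<in> P" "t2 \<notin> P" "t3 \<notin> P"
    by (rule P2_face)
  obtain Q where Q: "Q \<in> \<F>2" "x2 \<in> Q" "t2 \<in> Q" "t1 \<in> Q" "p0 \<in> Q" "w0 \<in> Q" "t0 \<notin> Q" "p5 \<notin> Q"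
    by (rule Q2_face)
  obtain F where F: "F \<in> \<F>2" "t3 \<in> F" "t4 \<in> F" "p5 \<in> F" "p4 \<in> F" by (rule square_face2)
  obtain u v D where f: "S2.fp x2 u v t4" and D: "D \<in> \<F>2" "x2 \<in> D" "u \<in> D" "v \<in> D" "t4 \<in> D"
    and c: "(v = x4 \<and> E x4 u) \<or> (v = t5 \<and> u = x5 \<and> t3 \<notin> D \<and> x4 \<in> D)"
    by (rule gain_x2_t4)
  have p: "distinct [x2, u, v, t4]" "E x2 u" "E u v" "E v t4" "E u x2"
    using S2.fp_path[OF f] S1.sym by auto
  from c show False
  proof
    assume "v = x4 \<and> E x4 u"
    then have "u = p0 \<or> u = p4" using x4_eq p nb3D(7)[OF np5'] by auto
    then show False using p x2_nonadj' x2_neqs n nb3D(7)[OF np0] by auto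
  next
    assume 2: "v = t5 \<and> u = x5 \<and> t3 \<notin> D \<and> x4 \<in> D"
    then have p5: "p5 \<in> D" using x4_eq by simp
    have "p4 \<notin> D" using S2.share3[OF D(1) F(1), of p5 p4 t4] F D 2 p5 neqs by auto
    then have p0: "p0 \<in> D" using S2.face_nb3[OF np5' D(1) p5] by blast
    have "t1 \<notin> D" using S2.share3[OF D(1) P(1), of t1 p0 p5] P D p0 p5 \<open>p4 \<notin> D\<close> neqs by auto
    then have "w0 \<in> D" using S2.face_nb3[OF np0 D(1) p0] by blast
    then have "D = Q" using S2.share3[OF D(1) Q(1), of x2 p0 w0] Q D p0 n x2_neqs
        edges9 S1.irrefl by auto
    then show False using Q p5 by blast
  qed
qed

lemma np0': "nb3 E p0 t1 p5 x2" using np0 w0_eq by simp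

lemma p0_x2: "E p0 x2" "E x2 p0" using nb3D(3)[OF np0'] S1.sym by blast+

lemma P_face':
  obtains P where "P \<in> \<F>1" "t0 \<in> P" "t1 \<in> P" "p0 \<in> P" "p5 \<in> P" "t4 \<in> P" "t5 \<in> P" "t2 \<notin> P" "t3 \<notin> P"
  using P_face x4_eq by metis

text \<open>The path \<open>t0 t5 t4 p5\<close> is facial only in the first system. Its replacement
  must reach \<open>p5\<close> from \<open>p4\<close>, so \<open>w4\<close> is a neighbour of
  \<open>t0\<close>; it is not \<open>t5\<close>, since the 4-cycle \<open>t3 t4 t5 p4\<close> would
  then coincide with \<open>A\<close>.\<close>

lemma w4_eq: "w4 = x0"
proof -
  obtain P1 where P1: "P1 \<in> \<F>1" "t0 \<in> P1" "t1 \<in> P1" "p0 \<in> P1" "p5 \<in> P1" "t4 \<in> P1" "t5 \<in> P1" "t2 \<notin> P1" "t3 \<notin> P1"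
    by (rule P_face')
  obtain P where P: "P \<in> \<F>2" "t0 \<in> P" "t1 \<in> P" "p0 \<in> P" "p5 \<in> P" "p4 \<in> P" "t2 \<notin> P" "t3 \<notin> P"
    by (rule P2_face)
  obtain A where A: "A \<in> \<F>2" "t0 \<in> A" "t1 \<in> A" "t2 \<in> A" "t3 \<in> A" "t4 \<in> A" "t5 \<in> A"
    "p4 \<notin> A" "x2 \<notin> A" "x0 \<notin> A" "x4 \<notin> A" "x5 \<notin> A" by (rule A2_face)
  have f1: "S1.fp t0 t5 t4 p5" using S1.fpI[OF P1(1)] P1 edges9 t4_p5 neqs by auto
  have f2: "\<not> S2.fp t0 t5 t4 p5" using S2.fp_face[OF _ A(1)] A x4_eq by blast
  obtain u v where uv: "S2.fp t0 u v p5" "\<not> S1.fp t0 u v p5" using exchange12[OF f1 f2] by blast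
  obtain D where D: "D \<in> \<F>2" "t0 \<in> D" "u \<in> D" "v \<in> D" "p5 \<in> D" using uv(1) by (rule S2.fpE)
  have p: "t0 \<noteq> u" "t0 \<noteq> v" "u \<noteq> v" "u \<noteq> p5" "v \<noteq> p5" "E t0 u" "E u v" "E v p5" "E p5 v" "E v u" "E u t0"
    using S2.fp_path[OF uv(1)] S1.sym by auto
  have t3: "u \<noteq> t3" using p nb3D(7)[OF nt3] neqs by metis
  have "v \<noteq> t4" using t3 p uv f2 nb3D(7)[OF nt4'] by metis
  \<comment> \<open>Via \<open>t1\<close> the path is already facial in the first system, hence no
    gain; via \<open>x2\<close> its face would be \<open>P\<close> and contain all three neighbours
    of \<open>p0\<close>.\<close>
  moreover have "v \<noteq> p0"
  proof
    assume v: "v = p0"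
    have "S1.fp t0 t1 p0 p5" using S1.fpI[OF P1(1)] P1 edges edges9 neqs by auto
    then have u: "u = x2" using v p uv nb3D(7)[OF np0'] by metis
    have "D = P" using S2.share3[OF D(1) P(1), of t0 p0 p5] D P v neqs by auto
    then show False using S2.face_nb3[OF np0' D(1)] D P u by blast
  qed
  ultimately have v: "v = p4" using p nb3D(7)[OF np5'] by blast
  then have "u = w4" using p t3 nb3D(7)[OF np4] by metis
  then have w: "w4 = t1 \<or> w4 = t5 \<or> w4 = x0" using p nb3D(7)[OF nt0] by metis
  have "w4 \<noteq> t1" using edges9 nb3D(7)[OF nt1] neqs' x2_neqs by metis
  moreover have "w4 \<noteq> t5"
  proof
    assume "w4 = t5"
    then obtain F where F: "F \<in> \<F>2" "{t3, t4, t5, p4} \<subseteq> F"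
      using S2.four_cycle_facial[of t3 t4 t5 p4] edges edges9 neqs' nb3D(7)[OF nt3] by auto
    have "F = A" using S2.share3[OF F(1) A(1), of t3 t4 t5] F A neqs by auto
    then show False using F A by blast
  qed
  ultimately show ?thesis using w by blast
qed

lemma np4': "nb3 E p4 t3 p5 x0" using np4 w4_eq by simp

lemma p4_x0: "E p4 x0" "E x0 p4" using nb3D(3)[OF np4'] S1.sym by blast+

lemma x0_neqs: "x0 \<noteq> t0" "x0 \<noteq> t1" "x0 \<noteq> t2" "x0 \<noteq> t3" "x0 \<noteq> t4" "x0 \<noteq> t5" "x0 \<noteq> p0" "x0 \<noteq> p4" "x0 \<noteq> p5" "x0 \<noteq> x2"
proof -
  show "x0 \<noteq> t0" "x0 \<noteq> p4" using edges9 p4_x0 S1.irrefl by metis+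
  show "x0 \<noteq> t1" "x0 \<noteq> t5" using neqs by auto
  show "x0 \<noteq> x2" using x2_nonadj' p4_x0 by metis
  show "x0 \<noteq> t3" "x0 \<noteq> t4" "x0 \<noteq> t2" "x0 \<noteq> p0" "x0 \<noteq> p5"
    using edges9 nb3D(7)[OF nt3] nb3D(7)[OF nt4'] nb3D(7)[OF nt2] nb3D(7)[OF np0'] nb3D(7)[OF np5']
      neqs' x2_neqs by metis+
qed

text \<open>If \<open>A\<close> contained \<open>t5\<close>, it would share \<open>t0\<close>,
  \<open>t1\<close>, \<open>t5\<close> with the face \<open>P1\<close>, which misses
  \<open>t2\<close>.\<close>

lemma A1_face: obtains A where "A \<in> \<F>1" "t0 \<in> A" "t1 \<in> A" "t2 \<in> A" "t3 \<in> A" "p4 \<in> A" "x0 \<in> A" "t4 \<notin> A"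
proof -
  obtain P1 where P1: "P1 \<in> \<F>1" "t0 \<in> P1" "t1 \<in> P1" "p0 \<in> P1" "p5 \<in> P1" "t4 \<in> P1" "t5 \<in> P1" "t2 \<notin> P1" "t3 \<notin> P1"
    by (rule P_face')
  obtain A where A: "A \<in> \<F>1" "t0 \<in> A" "t1 \<in> A" "t2 \<in> A" "t3 \<in> A" "p4 \<in> A" "t4 \<notin> A" "x2 \<notin> A"
    by (rule face_A1)
  have "t5 \<notin> A" using S1.share3[OF A(1) P1(1), of t0 t1 t5] A P1 neqs by auto
  then have "x0 \<in> A" using S1.face_nb3[OF nt0 A(1,2)] by blast
  then show thesis using that A by blast
qed

text \<open>The path \<open>x0 t0 t1 t2\<close> is lost in the second system. Reaching
  \<open>t2\<close> from \<open>t1\<close> gives only the lost path, from \<open>t3\<close> only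
  \<open>x0 p4 t3 t2\<close>, already facial in the first system. So the replacement ends in
  \<open>x2 t2\<close>, and its remaining inner vertex is adjacent to both \<open>x0\<close> and
  \<open>x2\<close>.\<close>

lemma x2_third: obtains v where "nb3 E x2 t2 p0 v" "E x0 v" "v \<noteq> t0" "v \<noteq> p4" "nb3 E x0 t0 p4 v"
proof -
  obtain v where v: "nb3 E x2 t2 p0 v"
    using cubic nb3_complete p0_x2 edges neqs' by metis
  obtain A1 where A1: "A1 \<in> \<F>1" "t0 \<in> A1" "t1 \<in> A1" "t2 \<in> A1" "t3 \<in> A1" "p4 \<in> A1" "x0 \<in> A1" "t4 \<notin> A1"
    by (rule A1_face)
  obtain A where A: "A \<in> \<F>2" "t0 \<in> A" "t1 \<in> A" "t2 \<in> A" "t3 \<in> A" "t4 \<in> A" "t5 \<in> A"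
    "p4 \<notin> A" "x2 \<notin> A" "x0 \<notin> A" "x4 \<notin> A" "x5 \<notin> A" by (rule A2_face)
  have f1: "S1.fp x0 t0 t1 t2" "S1.fp x0 p4 t3 t2"
    using S1.fpI[OF A1(1)] A1 edges edges9 p4_x0 x0_neqs neqs' by auto
  have f2: "\<not> S2.fp x0 t0 t1 t2" using S2.fp_face[OF S2.fp_sym A(1)] A by blast
  obtain u w where uw: "S2.fp x0 u w t2" "\<not> S1.fp x0 u w t2" using exchange12[OF f1(1) f2] by blast
  have p: "x0 \<noteq> u" "x0 \<noteq> w" "u \<noteq> w" "u \<noteq> t2" "w \<noteq> t2" "E x0 u" "E u w" "E w t2" "E t2 w" "E w u" "E u x0"
    using S2.fp_path[OF uw(1)] S1.sym by auto
  have p0: "u \<noteq> p0" using p nb3D(7)[OF np0'] x0_neqs by metis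
  have t4: "u \<noteq> t4" using p nb3D(7)[OF nt4'] x0_neqs by metis
  have "w \<noteq> t1" using p p0 f2 uw nb3D(7)[OF nt1] by metis
  moreover have "w \<noteq> t3" using p t4 f1 uw nb3D(7)[OF nt3] by metis
  ultimately have "w = x2" using p nb3D(7)[OF nt2] by blast
  then have uv: "u = v" using p p0 nb3D(7)[OF v] by metis
  have ex: "E x2 v" "E v x2" using nb3D(3)[OF v] S1.sym by blast+
  have "v \<noteq> p4" using ex x2_nonadj' by auto
  moreover have "v \<noteq> t0" using ex nb3D(7)[OF nt0] x2_neqs x0_neqs by metis
  moreover have "E x0 v" using p uv by simp
  moreover obtain y where y: "nb3 E x0 t0 p4 y"
    using cubic nb3_complete p4_x0(2) edges9 neqs by metis
  ultimately have "v = y" using nb3D(7)[OF y] by blast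
  then show thesis using that v y \<open>E x0 v\<close> \<open>v \<noteq> t0\<close> \<open>v \<noteq> p4\<close> by blast
qed

lemma x5_face1: obtains G where "G \<in> \<F>1" "t3 \<in> G" "t4 \<in> G" "t5 \<in> G" "x5 \<in> G"
proof -
  obtain P1 where P1: "P1 \<in> \<F>1" "t0 \<in> P1" "t1 \<in> P1" "p0 \<in> P1" "p5 \<in> P1" "t4 \<in> P1" "t5 \<in> P1" "t2 \<notin> P1" "t3 \<notin> P1"
    by (rule P_face')
  obtain G where G: "G \<in> \<F>1" "t3 \<in> G" "t4 \<in> G" "t5 \<in> G"
    using S1.corner[of t3 t4 t5] edges edges9 neqs by auto
  have "t0 \<notin> G" using S1.share3[OF G(1) P1(1), of t0 t4 t5] G P1 neqs by auto
  then have "x5 \<in> G" using S1.face_nb3[OF nt5 G(1,4)] by blast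
  then show thesis using that G by blast
qed

lemma x5_neqs: "x5 \<noteq> t0" "x5 \<noteq> t1" "x5 \<noteq> t2" "x5 \<noteq> t3" "x5 \<noteq> t4" "x5 \<noteq> t5" "x5 \<noteq> p0" "x5 \<noteq> p4" "x5 \<noteq> p5"
proof -
  show "x5 \<noteq> t0" "x5 \<noteq> t4" using neqs by auto
  show "x5 \<noteq> t5" using edges9 S1.irrefl by metis
  show "x5 \<noteq> t1" "x5 \<noteq> t2" "x5 \<noteq> t3" "x5 \<noteq> p0" "x5 \<noteq> p5" "x5 \<noteq> p4"
    using edges9 nb3D(7)[OF nt1] nb3D(7)[OF nt2] nb3D(7)[OF nt3] nb3D(7)[OF np0'] nb3D(7)[OF np5']
      nb3D(7)[OF np4'] neqs' x2_neqs x0_neqs by metis+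
qed

text \<open>The path \<open>x5 t5 t4 t3\<close> is facial only in the first system. Its replacement
  reaches \<open>t3\<close> from \<open>t2\<close> or \<open>p4\<close>, so it leaves
  \<open>x5\<close> towards \<open>x2\<close> or \<open>x0\<close>; hence \<open>x5\<close> is their
  common third neighbour.\<close>

lemma closing_vertex: "nb3 E x2 t2 p0 x5" "nb3 E x0 t0 p4 x5"
proof -
  obtain v where v: "nb3 E x2 t2 p0 v" "E x0 v" "v \<noteq> t0" "v \<noteq> p4" "nb3 E x0 t0 p4 v" by (rule x2_third)
  obtain G where G: "G \<in> \<F>1" "t3 \<in> G" "t4 \<in> G" "t5 \<in> G" "x5 \<in> G" by (rule x5_face1)
  obtain A where A: "A \<in> \<F>2" "t0 \<in> A" "t1 \<in> A" "t2 \<in> A" "t3 \<in> A" "t4 \<in> A" "t5 \<in> A"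
    "p4 \<notin> A" "x2 \<notin> A" "x0 \<notin> A" "x4 \<notin> A" "x5 \<notin> A" by (rule A2_face)
  have f1: "S1.fp x5 t5 t4 t3" using S1.fpI[OF G(1)] G edges edges9 x5_neqs neqs' by auto
  have f2: "\<not> S2.fp x5 t5 t4 t3" using S2.fp_face[OF S2.fp_sym A(1)] A by blast
  obtain u w where uw: "S2.fp x5 u w t3" "\<not> S1.fp x5 u w t3" using exchange12[OF f1 f2] by blast
  have p: "x5 \<noteq> u" "x5 \<noteq> w" "u \<noteq> w" "u \<noteq> t3" "w \<noteq> t3" "E x5 u" "E u w" "E w t3" "E t3 w" "E w u" "E u x5"
    using S2.fp_path[OF uw(1)] S1.sym by auto
  have u: "u \<noteq> t1" "u \<noteq> p5"
    using p x5_neqs nb3D(7)[OF nt1] nb3D(7)[OF np5'] by metis+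
  have "w \<noteq> t4" using p u f2 uw nb3D(7)[OF nt4'] by metis
  then have "w = t2 \<or> w = p4" using p nb3D(7)[OF nt3] by blast
  then have "u = x2 \<or> u = x0" using p u nb3D(7)[OF nt2] nb3D(7)[OF np4'] by metis
  then have "x5 = v" using p x5_neqs nb3D(7)[OF v(1)] nb3D(7)[OF v(5)] by metis
  then show "nb3 E x2 t2 p0 x5" "nb3 E x0 t0 p4 x5" using v by auto
qed

lemma x5_neqs': "x5 \<noteq> x0" "x5 \<noteq> x2"
  using nb3D(3)[OF closing_vertex(1)] nb3D(3)[OF closing_vertex(2)] S1.irrefl by metis+

lemma nx5: "nb3 E x5 t5 x0 x2"
proof -
  have e: "E x5 t5" "E x5 x0" "E x5 x2" "x0 \<noteq> t5" "x2 \<noteq> t5" "x0 \<noteq> x2"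
    using nb3D(3)[OF closing_vertex(1)] nb3D(3)[OF closing_vertex(2)] edges9 S1.sym
      x2_neqs x0_neqs by blast+
  obtain f where f: "nb3 E x5 t5 x0 f" using cubic nb3_complete[of E x5] e by metis
  then have "f = x2" using e nb3D(7)[OF f] by metis
  then show ?thesis using f by simp
qed

lemma distinct12: "distinct [t0, t1, t2, t3, t4, t5, p0, p4, p5, x0, x2, x5]"
  using distinct9 x0_neqs x2_neqs x5_neqs x5_neqs' by auto

text \<open>The two remaining hexagons of the first system, followed from one corner each; at every
  turn a known face rules out the other direction.\<close>

lemma third_faces:
  obtains B C where "B \<in> \<F>1" "{x2, t2, t3, t4, t5, x5} \<subseteq> B"
    "C \<in> \<F>1" "{p0, p5, p4, x0, x5, x2} \<subseteq> C"
proof -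
  obtain P1 where P1: "P1 \<in> \<F>1" "t0 \<in> P1" "t1 \<in> P1" "p0 \<in> P1" "p5 \<in> P1" "t4 \<in> P1" "t5 \<in> P1" "t2 \<notin> P1" "t3 \<notin> P1"
    by (rule P_face')
  obtain A1 where A1: "A1 \<in> \<F>1" "t0 \<in> A1" "t1 \<in> A1" "t2 \<in> A1" "t3 \<in> A1" "p4 \<in> A1" "x0 \<in> A1" "t4 \<notin> A1"
    by (rule A1_face)
  obtain F where F: "F \<in> \<F>1" "{t3, t4, p5, p4} \<subseteq> F"
    using S1.four_cycle_facial[of t3 t4 p5 p4] t3_p5 t4_p5 edges edges9 neqs' by auto
  obtain B where B: "B \<in> \<F>1" "x2 \<in> B" "t2 \<in> B" "t3 \<in> B" "t4 \<in> B" "t1 \<notin> B" by (rule face_B1)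
  have "p5 \<notin> B"
  proof
    assume "p5 \<in> B"
    then have "B = F" using S1.share3[OF B(1) F(1), of t3 t4 p5] B F neqs by auto
    then show False using S1.face_nb3[OF nt3 B(1,4)] F B by blast
  qed
  then have t5: "t5 \<in> B" using S1.face_nb3[OF nt4' B(1,5)] by blast
  have "t0 \<notin> B" using S1.share3[OF B(1) P1(1), of t0 t5 t4] B P1 t5 neqs by auto
  then have "x5 \<in> B" using S1.face_nb3[OF nt5 B(1) t5] by blast
  then have BB: "{x2, t2, t3, t4, t5, x5} \<subseteq> B" using B t5 by blast
  obtain C where C: "C \<in> \<F>1" "p0 \<in> C" "p5 \<in> C" "p4 \<in> C"
    using S1.corner[of p0 p5 p4] edges9 neqs by auto
  have t4: "t4 \<notin> C" using S1.face_nb3[OF np5' C(1,3)] C by blast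
  have "t1 \<notin> C" using S1.share3[OF C(1) P1(1), of p0 p5 t1] C P1 t4 neqs by auto
  then have x2: "x2 \<in> C" using S1.face_nb3[OF np0' C(1,2)] by blast
  have t3: "t3 \<notin> C" using S1.share3[OF C(1) F(1), of t3 p5 p4] C F t4 neqs by auto
  then have x0: "x0 \<in> C" using S1.face_nb3[OF np4' C(1,4)] by blast
  have "t0 \<notin> C" using S1.share3[OF C(1) A1(1), of t0 x0 p4] C A1 x0 t3 x0_neqs neqs by auto
  then have "x5 \<in> C" using S1.face_nb3[OF closing_vertex(2) C(1) x0] by blast
  then show thesis using that B(1) BB C x0 x2 by blast
qed

end

section \<open>From embeddings to face systems\<close>

lemma set_vwalk_arcs_nth: "set (vwalk_arcs xs) = {(xs ! i, xs ! Suc i) |i. Suc i < length xs}"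
proof (induction xs rule: vwalk_arcs.induct)
  case (3 x y xs)
  have "{((x # y # xs) ! i, (x # y # xs) ! Suc i) |i. Suc i < length (x # y # xs)}
    = insert (x, y) {((y # xs) ! i, (y # xs) ! Suc i) |i. Suc i < length (y # xs)}" (is "?L = ?R")
  proof
    show "?L \<subseteq> ?R"
    proof
      fix e assume "e \<in> ?L"
      then obtain i where i: "e = ((x # y # xs) ! i, (x # y # xs) ! Suc i)" "Suc i < length (x # y # xs)"
        by blast
      show "e \<in> ?R" using i by (cases i) auto
    qed
    show "?R \<subseteq> ?L"
    proof
      fix e assume "e \<in> ?R"
      then consider "e = (x, y)" | i where "e = ((y # xs) ! i, (y # xs) ! Suc i)" "Suc i < length (y # xs)"
        by blast
      then show "e \<in> ?L"
      proof cases
        case 1 then show ?thesis by (intro CollectI exI[of _ 0]) auto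
      next
        case (2 i) then show ?thesis by (intro CollectI exI[of _ "Suc i"]) auto
      qed
    qed
  qed
  with 3 show ?case by simp
qed auto

lemma closing_nth: "C \<noteq> [] \<Longrightarrow> i \<le> length C \<Longrightarrow> (C @ [hd C]) ! i = C ! (i mod length C)"
  by (auto simp: nth_append hd_conv_nth le_less)

lemma closed_walk_arcs:
  "C \<noteq> [] \<Longrightarrow> set (vwalk_arcs (C @ [hd C])) = {(C ! i, C ! (Suc i mod length C)) |i. i < length C}"
proof -
  assume "C \<noteq> []"
  then have "(C @ [hd C]) ! i = C ! i \<and> (C @ [hd C]) ! Suc i = C ! (Suc i mod length C)" if "i < length C" for i
    using closing_nth[of C i] closing_nth[of C "Suc i"] that by simp
  then show ?thesis
    unfolding set_vwalk_arcs_nth by (intro Collect_cong) (metis Suc_less_eq length_append_singleton)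
qed

lemma cycle_edges_nth:
  "C \<noteq> [] \<Longrightarrow> cycle_edges C = {{C ! i, C ! (Suc i mod length C)} |i. i < length C}"
  unfolding cycle_edges_def by (simp add: closed_walk_arcs) blast

lemma Union_cycle_edges: "C \<noteq> [] \<Longrightarrow> \<Union>(cycle_edges C) = set C"
  by (auto simp: cycle_edges_nth set_conv_nth)

lemma is_cycleD:
  assumes "is_cycle G C"
  shows "3 \<le> length C" "distinct C" "C \<noteq> []" "set C \<subseteq> pverts G"
    and "\<And>i. i < length C \<Longrightarrow> (C ! i, C ! (Suc i mod length C)) \<in> parcs G"
proof -
  show C: "3 \<le> length C" "distinct C" "C \<noteq> []" using assms by (auto simp: is_cycle_def)
  show "set C \<subseteq> pverts G" using assms by (auto simp: is_cycle_def vwalk_def)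
  have "set (vwalk_arcs (C @ [hd C])) \<subseteq> parcs G"
    using assms by (auto simp: is_cycle_def vwalk_def)
  then show "\<And>i. i < length C \<Longrightarrow> (C ! i, C ! (Suc i mod length C)) \<in> parcs G"
    unfolding closed_walk_arcs[OF C(3)] by blast
qed

lemma Suc_mod_inj: "i < n \<Longrightarrow> j < n \<Longrightarrow> Suc i mod n = Suc j mod n \<Longrightarrow> i = j"
  by (auto simp: mod_Suc split: if_splits)

text \<open>The vertex is indexed as a successor so that its predecessor is \<open>C ! j\<close>,
  without subtraction modulo the length.\<close>

lemma cycle_neighbours:
  assumes "distinct C" "j < length C" "{C ! (Suc j mod length C), d} \<in> cycle_edges C"
  shows "d = C ! j \<or> d = C ! (Suc (Suc j) mod length C)"
proof -
  let ?n = "length C"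
  have "C \<noteq> []" using assms(2) by auto
  then obtain k where k: "k < ?n" "{C ! (Suc j mod ?n), d} = {C ! k, C ! (Suc k mod ?n)}"
    using assms(3) by (auto simp: cycle_edges_nth)
  have "0 < ?n" using assms(2) by linarith
  then have m: "Suc j mod ?n < ?n" "Suc k mod ?n < ?n" by simp_all
  consider "C ! (Suc j mod ?n) = C ! k" "d = C ! (Suc k mod ?n)"
    | "C ! (Suc j mod ?n) = C ! (Suc k mod ?n)" "d = C ! k"
    using k(2) by (metis doubleton_eq_iff)
  then show ?thesis
  proof cases
    case 1
    then have "Suc j mod ?n = k" using assms(1) m k nth_eq_iff_index_eq by blast
    then show ?thesis using 1 by (metis mod_Suc_eq)
  next
    case 2
    then have "Suc j mod ?n = Suc k mod ?n" using assms(1) m k nth_eq_iff_index_eq by blast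
    then have "j = k" using Suc_mod_inj assms(2) k(1) by blast
    then show ?thesis using 2 by blast
  qed
qed

lemma cycle_pred: assumes "i < n" obtains j where "j < n" "Suc j mod n = (i :: nat)"
proof (cases i)
  case 0
  then show ?thesis using that[of "n - 1"] assms by simp
next
  case (Suc j)
  then show ?thesis using that[of j] assms by simp
qed

lemma prefix4:
  assumes "4 \<le> length xs" "xs ! 0 = a" "xs ! 1 = b" "xs ! 2 = c" "xs ! 3 = d"
  shows "prefix [a, b, c, d] xs"
proof -
  have "take 4 xs = [a, b, c, d]"
    using assms by (intro nth_equalityI) (auto simp: less_Suc_eq numeral_eq_Suc)
  then show ?thesis by (metis take_is_prefix)
qed

text \<open>The position of the middle edge \<open>b c\<close> fixes the direction; as
  \<open>a\<close> differs from \<open>c\<close> and \<open>d\<close> from \<open>b\<close>, they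
  must be the outer cycle neighbours, and rotating to the position of \<open>a\<close> exposes the
  path.\<close>

lemma cycle_path4_prefix:
  assumes C: "distinct C" "j < length C" and p: "distinct [a, b, c, d]" "{a, b, c, d} \<subseteq> set C"
    and e: "{a, b} \<in> cycle_edges C" "{c, d} \<in> cycle_edges C"
    and bc: "b = C ! j" "c = C ! (Suc j mod length C)"
  shows "\<exists>i. prefix [a, b, c, d] (rotate i C)"
proof -
  let ?n = "length C"
  have n: "4 \<le> ?n"
  proof -
    have "card {a, b, c, d} = 4" using p(1) by simp
    then show ?thesis using card_mono[OF _ p(2)] card_length[of C] by simp
  qed
  obtain k where k: "k < ?n" "Suc k mod ?n = j" using C(2) by (rule cycle_pred)
  have "a = C ! k \<or> a = C ! (Suc (Suc k) mod ?n)"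
    using cycle_neighbours[OF C(1) k(1), of a] e(1) k(2) bc by (simp add: insert_commute)
  moreover have "C ! (Suc (Suc k) mod ?n) = c" using k bc by (metis mod_Suc_eq)
  ultimately have a: "a = C ! k" using p(1) by auto
  have "d = C ! j \<or> d = C ! (Suc (Suc j) mod ?n)"
    using cycle_neighbours[OF C, of d] e(2) bc by simp
  then have d: "d = C ! (Suc (Suc (Suc k)) mod ?n)" using p(1) bc k by (auto simp: mod_Suc_eq) (metis mod_Suc_eq)
  have r: "rotate k C ! m = C ! ((k + m) mod ?n)" if "m < 4" for m
    using nth_rotate[of m C k] that n by simp
  have "prefix [a, b, c, d] (rotate k C)"
  proof (rule prefix4)
    show "4 \<le> length (rotate k C)" using n by simp
    show "rotate k C ! 0 = a" using r[of 0] a k by simp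
    show "rotate k C ! 1 = b" using r[of 1] bc k by simp
    show "rotate k C ! 2 = c" using r[of 2] \<open>C ! (Suc (Suc k) mod ?n) = c\<close> by simp
    show "rotate k C ! 3 = d" using r[of 3] d by (simp add: numeral_eq_Suc)
  qed
  then show ?thesis by blast
qed

lemma cyclic_no_fixpoint:
  assumes "cyclic_on r S" "x \<in> S" "y \<in> S" "x \<noteq> y" shows "r x \<noteq> x"
proof
  assume "r x = x"
  then have "S = {x}" using assms(1,2) by (metis cyclic_on_alldef orbit_eq_singleton_iff)
  then show False using assms by auto
qed

text \<open>In a 3-cycle the successor and the predecessor of \<open>a\<close> are the other two
  elements, so every corner at a cubic vertex is a turn one way or the other.\<close>

lemma rotation_cubic:
  assumes "r permutes S" "cyclic_on r S" "S = {a, c, e}" "distinct [a, c, e]"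
  shows "r a = c \<or> inv r a = c"
proof (rule ccontr)
  assume n: "\<not> (r a = c \<or> inv r a = c)"
  have S: "a \<in> S" "c \<in> S" "e \<in> S" "a \<noteq> c" "a \<noteq> e" "c \<noteq> e" using assms(3,4) by auto
  have fix1: "r a \<noteq> a" "r c \<noteq> c" using cyclic_no_fixpoint[OF assms(2)] S by metis+
  have "r a \<in> S" "r c \<in> S" using S assms(1) by (simp_all add: permutes_in_image)
  then have "r a = e" "r c = a \<or> r c = e" using n fix1 assms(3) by auto
  moreover have "r a \<noteq> r c" using S permutes_inj[OF assms(1)] by (metis injD)
  ultimately have "r c = a" by auto
  then show False using n assms(1) by (simp add: permutes_inv_eq)
qed

section \<open>Faces of a polyhedral embedding as a face system\<close>

locale polyhedral_cubic =
  fixes G :: "'a pair_pre_digraph" and \<Phi> :: "'a embedding"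
  assumes graph: "pair_graph G" and cubic: "cubic G" and polyhedral: "polyhedral_embedding G \<Phi>"
begin

sublocale pair_graph G by (rule graph)

abbreviation adj :: "'a \<Rightarrow> 'a \<Rightarrow> bool" where "adj u v \<equiv> (u, v) \<in> parcs G"

lemma adj_sym: "adj u v \<Longrightarrow> adj v u"
  using pair_sym_arcs by (auto simp: symmetric_def sym_def)

lemma adj_irrefl: "\<not> adj v v"
  using pair_no_loops[of "(v, v)"] by auto

lemma adj_verts: "adj u v \<Longrightarrow> u \<in> pverts G" "adj u v \<Longrightarrow> v \<in> pverts G"
  using in_arcsD1 in_arcsD2 by auto

lemma vertex_nb3: assumes "v \<in> pverts G" shows "\<exists>a b c. nb3 adj v a b c"
proof -
  have "card {e \<in> parcs G. fst e = v} = 3"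
    using cubic assms by (auto simp: cubic_def out_degree_def out_arcs_def)
  moreover have "{e \<in> parcs G. fst e = v} = Pair v ` nbrs G v" by force
  ultimately have "card (nbrs G v) = 3" by (simp add: card_image inj_on_def)
  then obtain a b c where "nbrs G v = {a, b, c}" "a \<noteq> b" "a \<noteq> c" "b \<noteq> c"
    by (auto simp: card_3_iff)
  then show ?thesis by (intro exI[of _ a] exI[of _ b] exI[of _ c]) (auto simp: nb3_def)
qed

lemma face_cycle: "C \<in> facial_walks G \<Phi> \<Longrightarrow> is_cycle G C"
  using polyhedral by (auto simp: polyhedral_embedding_def)

lemmas faceD = is_cycleD[OF face_cycle]

lemma face_inter:
  assumes "C \<in> facial_walks G \<Phi>" "D \<in> facial_walks G \<Phi>" "cycle_edges C \<noteq> cycle_edges D"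
    "a \<in> set C" "a \<in> set D" "b \<in> set C" "b \<in> set D" "a \<noteq> b"
  shows "set C \<inter> set D = {a, b}" "cycle_edges C \<inter> cycle_edges D = {{a, b}}"
proof -
  let ?S = "set C \<inter> set D"
  have ab: "a \<in> ?S" "b \<in> ?S" using assms(4-7) by simp_all
  have "?S = {} \<or> (\<exists>v. ?S = {v}) \<or> (\<exists>u v. ?S = {u, v} \<and> cycle_edges C \<inter> cycle_edges D = {{u, v}})"
    using polyhedral assms(1-3) unfolding polyhedral_embedding_def by blast
  then obtain u v where uv: "?S = {u, v}" "cycle_edges C \<inter> cycle_edges D = {{u, v}}"
    using ab assms(8) by (metis empty_iff singletonD)
  have "a \<in> {u, v}" "b \<in> {u, v}" using ab uv(1) by simp_all
  then have "{u, v} = {a, b}" using assms(8) by auto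
  then show "?S = {a, b}" "cycle_edges C \<inter> cycle_edges D = {{a, b}}" using uv by simp_all
qed

lemma cycle_edge_adj:
  assumes "C \<in> facial_walks G \<Phi>" "{a, b} \<in> cycle_edges C" shows "adj a b"
proof -
  obtain i where "i < length C" "{a, b} = {C ! i, C ! (Suc i mod length C)}"
    using assms faceD(3)[OF assms(1)] by (auto simp: cycle_edges_nth)
  then show ?thesis using faceD(5)[OF assms(1)] adj_sym by (metis doubleton_eq_iff)
qed

lemma facial_walk_nth_step:
  "i < length (facial_walk \<Phi> d) \<Longrightarrow> facial_walk \<Phi> d ! i = fst ((face_step \<Phi> ^^ i) d)"
  by (simp add: facial_walk_def del: upt_Suc)

lemma facial_walk_nth:
  assumes "C = facial_walk \<Phi> (u, v, s)" "(u, v) \<in> parcs G" "i < 3"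
  shows "C \<in> facial_walks G \<Phi>" "C ! i = fst ((face_step \<Phi> ^^ i) (u, v, s))"
proof -
  show C: "C \<in> facial_walks G \<Phi>" using assms by (auto simp: facial_walks_def)
  have "i < length C" using faceD(1)[OF C] assms(3) by simp
  then show "C ! i = fst ((face_step \<Phi> ^^ i) (u, v, s))"
    unfolding assms(1) by (rule facial_walk_nth_step)
qed

lemma edge_face:
  assumes "adj u v" obtains D where "D \<in> facial_walks G \<Phi>" "{u, v} \<in> cycle_edges D"
proof -
  define D where "D = facial_walk \<Phi> (u, v, True)"
  note w = facial_walk_nth[OF D_def assms]
  have D: "D \<in> facial_walks G \<Phi>" using w(1)[of 0] by simp
  have "D ! 0 = u" using w(2)[of 0] by simp
  moreover have "D ! 1 = v" using w(2)[of 1] by (simp add: Let_def)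
  moreover have "1 < length D" using faceD(1)[OF D] by simp
  ultimately have "{u, v} \<in> cycle_edges D"
    using faceD(3)[OF D] by (auto simp: cycle_edges_nth intro!: exI[of _ 0])
  then show thesis using that D by blast
qed

text \<open>Some face \<open>D\<close> runs along the edge \<open>u v\<close>. If it differs from
  \<open>C\<close>, the two meet in \<open>u\<close> and \<open>v\<close>, and polyhedrality makes
  \<open>u v\<close> an edge of both; so faces have no chords.\<close>

lemma face_induced:
  assumes "C \<in> facial_walks G \<Phi>" "u \<in> set C" "v \<in> set C" "adj u v"
  shows "{u, v} \<in> cycle_edges C"
proof (rule ccontr)
  assume n: "{u, v} \<notin> cycle_edges C"
  obtain D where D: "D \<in> facial_walks G \<Phi>" "{u, v} \<in> cycle_edges D" using edge_face assms(4) .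
  have uvD: "u \<in> set D" "v \<in> set D" using D Union_cycle_edges[OF faceD(3)[OF D(1)]] by auto
  have "u \<noteq> v" using assms(4) adj_irrefl by auto
  moreover have "cycle_edges C \<noteq> cycle_edges D" using D n by auto
  ultimately have "cycle_edges C \<inter> cycle_edges D = {{u, v}}"
    using face_inter(2)[OF assms(1) D(1) _ assms(2) uvD(1) assms(3) uvD(2)] by simp
  then show False using n by blast
qed

lemma corner_face:
  assumes "adj a b" "adj b c" "a \<noteq> c"
  shows "\<exists>F\<in>set ` facial_walks G \<Phi>. a \<in> F \<and> b \<in> F \<and> c \<in> F"
proof -
  obtain e where e: "nb3 adj b a c e"
    using vertex_nb3[OF adj_verts(1)[OF assms(2)]] nb3_complete adj_sym[OF assms(1)] assms(2,3) by metis
  let ?r = "rotation \<Phi> b"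
  have r: "?r permutes nbrs G b" "cyclic_on ?r (nbrs G b)"
    using polyhedral adj_verts assms by (auto simp: polyhedral_embedding_def is_embedding_def)
  have "nbrs G b = {a, c, e}" "distinct [a, c, e]" using e by (auto simp: nb3_def)
  then have "?r a = c \<or> inv ?r a = c" using rotation_cubic[OF r] by blast
  then obtain s' where s': "(if s' then ?r a else inv ?r a) = c" by (metis (full_types))
  \<comment> \<open>Crossing \<open>a b\<close> flips the side exactly when the sign is negative, so
    the initial side is computed backwards from the side \<open>s'\<close> that turns to
    \<open>c\<close>.\<close>
  define s where "s = (if signature \<Phi> {a, b} then s' else \<not> s')"
  have f: "face_step \<Phi> (a, b, s) = (b, c, s')" using s' by (auto simp: s_def Let_def)
  define C where "C = facial_walk \<Phi> (a, b, s)"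
  note w = facial_walk_nth[OF C_def assms(1)]
  have C: "C \<in> facial_walks G \<Phi>" using w(1)[of 0] by simp
  have "C ! 0 = a" "C ! 1 = b" "C ! 2 = c"
    using w(2)[of 0] w(2)[of 1] w(2)[of 2] f by (simp_all add: numeral_2_eq_2 Let_def del: face_step.simps)
      (simp add: Let_def)
  moreover have "0 < length C" "1 < length C" "2 < length C" using faceD(1)[OF C] by linarith+
  ultimately have "a \<in> set C \<and> b \<in> set C \<and> c \<in> set C" by (metis nth_mem)
  then show ?thesis using C by blast
qed

lemma face_neighbours:
  assumes "C \<in> facial_walks G \<Phi>" "v \<in> set C"
  shows "\<exists>a b. a \<noteq> b \<and> {u \<in> set C. adj v u} = {a, b}"
proof -
  let ?n = "length C"
  note C = faceD[OF assms(1)]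
  obtain i where i: "i < ?n" "C ! i = v" using assms(2) by (auto simp: in_set_conv_nth)
  obtain j where j: "j < ?n" "Suc j mod ?n = i" using i(1) by (rule cycle_pred)
  have a: "adj (C ! j) v" using C(5)[OF j(1)] j i by simp
  have b: "adj v (C ! (Suc (Suc j) mod ?n))" using C(5)[OF i(1)] i j by (metis mod_Suc_eq)
  have "0 < ?n" using j(1) by linarith
  then have l: "Suc (Suc j) mod ?n < ?n" by (rule mod_less_divisor)
  have "j \<noteq> Suc (Suc j) mod ?n" using C(1) j(1) by (auto simp: mod_Suc split: if_splits)
  then have ne: "C ! j \<noteq> C ! (Suc (Suc j) mod ?n)" using nth_eq_iff_index_eq[OF C(2) j(1) l] by blast
  have "u = C ! j \<or> u = C ! (Suc (Suc j) mod ?n)" if "u \<in> set C" "adj v u" for u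
    using cycle_neighbours[OF C(2) j(1), of u] face_induced[OF assms that] i j by simp
  then have "{u \<in> set C. adj v u} = {C ! j, C ! (Suc (Suc j) mod ?n)}"
    using a b adj_sym nth_mem[OF j(1)] nth_mem[OF l] by auto
  then show ?thesis using ne by blast
qed

sublocale F: face_system adj "set ` facial_walks G \<Phi>"
proof
  show "adj u v \<Longrightarrow> adj v u" for u v by (rule adj_sym)
  show "\<not> adj v v" for v by (rule adj_irrefl)
  show "\<exists>F\<in>set ` facial_walks G \<Phi>. a \<in> F \<and> b \<in> F \<and> c \<in> F" if "adj a b" "adj b c" "a \<noteq> c" for a b c
    using corner_face that by blast
  show "\<exists>a b. a \<noteq> b \<and> {u \<in> F. adj v u} = {a, b}" if "F \<in> set ` facial_walks G \<Phi>" "v \<in> F" for F v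
    using face_neighbours that by auto
next
  fix F F' a b
  assume "F \<in> set ` facial_walks G \<Phi>" "F' \<in> set ` facial_walks G \<Phi>"
  then obtain C D where CD: "C \<in> facial_walks G \<Phi>" "D \<in> facial_walks G \<Phi>" "F = set C" "F' = set D"
    by blast
  assume ab: "a \<in> F" "b \<in> F" "a \<in> F'" "b \<in> F'" "a \<noteq> b"
  have eq: "cycle_edges C = cycle_edges D \<Longrightarrow> F = F'"
    using Union_cycle_edges faceD(3) CD by metis
  {
    assume "\<not> adj a b"
    \<comment> \<open>Faces with different edge sets that meet in \<open>a\<close> and
      \<open>b\<close> would have \<open>{a, b}\<close> as a common edge.\<close>
    then have "{a, b} \<notin> cycle_edges C" using cycle_edge_adj[OF CD(1)] by blast
    then have "cycle_edges C \<inter> cycle_edges D \<noteq> {{a, b}}" by blast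
    then have "cycle_edges C = cycle_edges D"
      using face_inter(2)[OF CD(1,2), of a b] ab CD(3,4) by metis
    then show "F = F'" by (rule eq)
  }
next
  fix F F' a b c
  assume "F \<in> set ` facial_walks G \<Phi>" "F' \<in> set ` facial_walks G \<Phi>"
  then obtain C D where CD: "C \<in> facial_walks G \<Phi>" "D \<in> facial_walks G \<Phi>" "F = set C" "F' = set D"
    by blast
  assume a: "a \<in> F" "b \<in> F" "c \<in> F" "a \<in> F'" "b \<in> F'" "c \<in> F'" "distinct [a, b, c]"
  then have "c \<in> set C \<inter> set D" "c \<notin> {a, b}" "a \<noteq> b" using CD by auto
  then have "cycle_edges C = cycle_edges D"
    using face_inter(1)[OF CD(1,2), of a b] a CD(3,4) by metis
  then show "F = F'" using Union_cycle_edges faceD(3) CD by metis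
qed

text \<open>The bridge from rotated lists to vertex sets: since faces are induced, the three edges
  of the path lie on the cycle, and the position of \<open>b c\<close> decides whether the path or
  its reversal is a prefix.\<close>

lemma path_facial_iff:
  assumes "distinct [a, b, c, d]" "adj a b" "adj b c" "adj c d"
  shows "facial_subwalk G \<Phi> [a, b, c, d] \<longleftrightarrow> F.fp a b c d"
proof
  assume "facial_subwalk G \<Phi> [a, b, c, d]"
  then obtain C i where C: "C \<in> facial_walks G \<Phi>"
    "prefix [a, b, c, d] (rotate i C) \<or> prefix (rev [a, b, c, d]) (rotate i C)"
    unfolding facial_subwalk_def by blast
  then have "{a, b, c, d} \<subseteq> set C"
    using set_mono_prefix[of "[a, b, c, d]" "rotate i C"] set_mono_prefix[of "rev [a, b, c, d]" "rotate i C"]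
    by auto
  then show "F.fp a b c d" using C(1) assms unfolding F.fp_def by blast
next
  assume "F.fp a b c d"
  then obtain C where C: "C \<in> facial_walks G \<Phi>" "{a, b, c, d} \<subseteq> set C"
    unfolding F.fp_def by blast
  have e: "{a, b} \<in> cycle_edges C" "{b, c} \<in> cycle_edges C" "{c, d} \<in> cycle_edges C"
    using face_induced[OF C(1)] C(2) assms by auto
  then obtain j where j: "j < length C" "{b, c} = {C ! j, C ! (Suc j mod length C)}"
    using faceD(3)[OF C(1)] by (auto simp: cycle_edges_nth)
  have "\<exists>i. prefix [a, b, c, d] (rotate i C) \<or> prefix [d, c, b, a] (rotate i C)"
  proof (cases "b = C ! j")
    case True
    then have "c = C ! (Suc j mod length C)" using j assms by (auto simp: doubleton_eq_iff)
    then show ?thesis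
      using cycle_path4_prefix[OF faceD(2)[OF C(1)] j(1), of a b c d] True assms C e by blast
  next
    case False
    then have "c = C ! j" "b = C ! (Suc j mod length C)" using j by (auto simp: doubleton_eq_iff)
    moreover have "distinct [d, c, b, a]" "{d, c, b, a} \<subseteq> set C"
      "{d, c} \<in> cycle_edges C" "{b, a} \<in> cycle_edges C"
      using assms(1) C(2) e by (auto simp: insert_commute)
    ultimately show ?thesis
      using cycle_path4_prefix[OF faceD(2)[OF C(1)] j(1), of d c b a] by blast
  qed
  then show "facial_subwalk G \<Phi> [a, b, c, d]" using C(1) unfolding facial_subwalk_def by auto
qed

lemma facial_3paths_eq: "facial_3paths G \<Phi> = {[a, b, c, d] |a b c d. F.fp a b c d}"
proof (intro set_eqI iffI)
  fix p assume p: "p \<in> facial_3paths G \<Phi>"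
  then have "length p = 4" by (simp add: facial_3paths_def)
  then obtain a b c d where pe: "p = [a, b, c, d]"
    by (auto simp: numeral_eq_Suc length_Suc_conv)
  have v: "distinct [a, b, c, d]" "adj a b" "adj b c" "adj c d" "facial_subwalk G \<Phi> [a, b, c, d]"
    using p unfolding facial_3paths_def pe by (auto simp: vpath_def vwalk_def)
  then show "p \<in> {[a, b, c, d] |a b c d. F.fp a b c d}" using path_facial_iff pe by blast
next
  fix p assume "p \<in> {[a, b, c, d] |a b c d. F.fp a b c d}"
  then obtain a b c d where pe: "p = [a, b, c, d]" and f: "F.fp a b c d" by blast
  have v: "distinct [a, b, c, d]" "adj a b" "adj b c" "adj c d" using F.fp_path[OF f] by auto
  then show "p \<in> facial_3paths G \<Phi>"
    using path_facial_iff[OF v] f adj_verts unfolding facial_3paths_def pe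
    by (auto simp: vpath_def vwalk_def)
qed

lemma finite_facial_3paths: "finite (facial_3paths G \<Phi>)"
proof (rule finite_subset)
  show "facial_3paths G \<Phi> \<subseteq> {p. set p \<subseteq> pverts G \<and> length p = 4}"
    by (auto simp: facial_3paths_def vpath_def vwalk_def)
  show "finite {p. set p \<subseteq> pverts G \<and> length p = 4}"
    using pair_finite_verts by (rule finite_lists_length_eq)
qed

section \<open>Multiplicities of scaffold edges and the exchange property\<close>

text \<open>The fibre of the scaffold map over \<open>{a, d}\<close>; its cardinality is the
  multiplicity of that scaffold edge.\<close>

definition path_classes :: "'a \<Rightarrow> 'a \<Rightarrow> 'a list set set" where
  "path_classes a d = {{p, rev p} |p. p \<in> facial_3paths G \<Phi> \<and> {hd p, last p} = {a, d}}"

lemma finite_path_classes: "finite (path_classes a d)"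
proof -
  have "path_classes a d \<subseteq> (\<lambda>p. {p, rev p}) ` facial_3paths G \<Phi>" by (auto simp: path_classes_def)
  then show ?thesis using finite_facial_3paths finite_subset by blast
qed

lemma class_ends: "p \<noteq> [] \<Longrightarrow> (\<Union>q\<in>{p, rev p}. {hd q, last q}) = {hd p, last p}"
  by (auto simp: hd_rev last_rev)

lemma count_scaffold: "count (scaffold_edges G \<Phi>) {a, d} = card (path_classes a d)"
proof -
  let ?X = "{{p, rev p} |p. p \<in> facial_3paths G \<Phi>}"
  let ?f = "\<lambda>P. \<Union>q\<in>P. {hd q, last q}"
  have X: "?X = (\<lambda>p. {p, rev p}) ` facial_3paths G \<Phi>" by blast
  have fin: "finite ?X" unfolding X using finite_facial_3paths by (rule finite_imageI)
  have ne: "p \<noteq> []" if "p \<in> facial_3paths G \<Phi>" for p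
    using that by (auto simp: facial_3paths_def)
  have f: "?f {p, rev p} = {hd p, last p}" if "p \<in> facial_3paths G \<Phi>" for p
    using class_ends ne[OF that] by blast
  have "{P \<in> ?X. {a, d} = ?f P} = path_classes a d"
  proof (intro set_eqI iffI)
    fix P assume "P \<in> {P \<in> ?X. {a, d} = ?f P}"
    then obtain p where p: "P = {p, rev p}" "p \<in> facial_3paths G \<Phi>" "{a, d} = ?f P" by blast
    moreover have "?f P = {hd p, last p}" unfolding p(1) by (rule f[OF p(2)])
    ultimately have "{hd p, last p} = {a, d}" by (simp only:)
    then show "P \<in> path_classes a d" using p(1,2) unfolding path_classes_def by blast
  next
    fix P assume "P \<in> path_classes a d"
    then obtain p where p: "P = {p, rev p}" "p \<in> facial_3paths G \<Phi>" "{hd p, last p} = {a, d}"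
      unfolding path_classes_def by blast
    moreover have "?f P = {hd p, last p}" unfolding p(1) by (rule f[OF p(2)])
    ultimately have "{a, d} = ?f P" by (simp only:)
    then show "P \<in> {P \<in> ?X. {a, d} = ?f P}" using p(1,2) by blast
  qed
  moreover have "count (scaffold_edges G \<Phi>) {a, d} = card {P \<in> ?X. {a, d} = ?f P}"
    unfolding scaffold_edges_def count_image_mset' using fin by simp
  ultimately show ?thesis by simp
qed

lemma fp_path_class:
  assumes "F.fp a b c d" shows "{[a, b, c, d], [d, c, b, a]} \<in> path_classes a d"
  using assms unfolding path_classes_def facial_3paths_eq
  by (intro CollectI exI[of _ "[a, b, c, d]"]) auto

lemma path_class_fp:
  assumes "P \<in> path_classes a d"
  obtains b c where "F.fp a b c d" "P = {[a, b, c, d], [d, c, b, a]}"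
proof -
  obtain p where p: "P = {p, rev p}" "p \<in> facial_3paths G \<Phi>" "{hd p, last p} = {a, d}"
    using assms unfolding path_classes_def by blast
  obtain a' b c d' where f: "p = [a', b, c, d']" "F.fp a' b c d'"
    using p(2) unfolding facial_3paths_eq by blast
  have "a' = a \<and> d' = d \<or> a' = d \<and> d' = a" using p(3) f(1) by (auto simp: doubleton_eq_iff)
  then show thesis
  proof
    assume "a' = a \<and> d' = d"
    then show thesis using that[of b c] p(1) f by simp
  next
    assume "a' = d \<and> d' = a"
    then show thesis using that[of c b] p(1) f(1) F.fp_sym[OF f(2)] by (simp add: insert_commute)
  qed
qed

lemma in_scaffold_iff: "{a, d} \<in># scaffold_edges G \<Phi> \<longleftrightarrow> (\<exists>b c. F.fp a b c d)"
proof -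
  have "{a, d} \<in># scaffold_edges G \<Phi> \<longleftrightarrow> 0 < card (path_classes a d)"
    by (simp only: count_scaffold flip: count_greater_zero_iff)
  also have "\<dots> \<longleftrightarrow> path_classes a d \<noteq> {}"
    using finite_path_classes by (simp only: card_gt_0_iff simp_thms)
  also have "\<dots> \<longleftrightarrow> (\<exists>b c. F.fp a b c d)"
  proof
    assume "path_classes a d \<noteq> {}"
    then obtain P where "P \<in> path_classes a d" by blast
    then show "\<exists>b c. F.fp a b c d" by (rule path_class_fp) blast
  next
    assume "\<exists>b c. F.fp a b c d"
    then show "path_classes a d \<noteq> {}" using fp_path_class by blast
  qed
  finally show ?thesis .
qed

end

text \<open>The class of the lost path lies in one of two finite sets of equal size but not in the
  other, so the other is not contained in the first and supplies a new class.\<close>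

lemma scaffold_exchange:
  assumes "polyhedral_cubic G \<Phi>" "polyhedral_cubic G \<Psi>" "scaffold_edges G \<Phi> = scaffold_edges G \<Psi>"
    and f: "face_system.fp (\<lambda>u v. (u, v) \<in> parcs G) (set ` facial_walks G \<Phi>) a b c d"
    and n: "\<not> face_system.fp (\<lambda>u v. (u, v) \<in> parcs G) (set ` facial_walks G \<Psi>) a b c d"
  shows "\<exists>b' c'. face_system.fp (\<lambda>u v. (u, v) \<in> parcs G) (set ` facial_walks G \<Psi>) a b' c' d \<and>
    \<not> face_system.fp (\<lambda>u v. (u, v) \<in> parcs G) (set ` facial_walks G \<Phi>) a b' c' d"
proof -
  interpret P: polyhedral_cubic G \<Phi> by fact
  interpret Q: polyhedral_cubic G \<Psi> by fact
  let ?A = "{[a, b, c, d], [d, c, b, a]}"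
  have A: "?A \<in> P.path_classes a d" using P.fp_path_class f by blast
  have ad: "a \<noteq> d" using P.F.fp_path[OF f] by auto
  have "?A \<notin> Q.path_classes a d"
  proof
    assume "?A \<in> Q.path_classes a d"
    then obtain b' c' where "Q.F.fp a b' c' d" "?A = {[a, b', c', d], [d, c', b', a]}"
      by (rule Q.path_class_fp)
    \<comment> \<open>Distinct ends fix the orientation, so equal classes mean equal paths.\<close>
    moreover have "[a, b, c, d] \<noteq> [d, c', b', a]" using ad by simp
    ultimately have "[a, b, c, d] = [a, b', c', d]" by (metis doubleton_eq_iff)
    then show False using n \<open>Q.F.fp a b' c' d\<close> by simp
  qed
  moreover have "card (P.path_classes a d) = card (Q.path_classes a d)"
    using P.count_scaffold Q.count_scaffold assms(3) by metis
  ultimately have "\<not> Q.path_classes a d \<subseteq> P.path_classes a d"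
    using A card_subset_eq[OF P.finite_path_classes] by metis
  then obtain B where B: "B \<in> Q.path_classes a d" "B \<notin> P.path_classes a d" by blast
  obtain b' c' where "Q.F.fp a b' c' d" "B = {[a, b', c', d], [d, c', b', a]}"
    using B(1) by (rule Q.path_class_fp)
  moreover have "\<not> P.F.fp a b' c' d" using B(2) P.fp_path_class calculation(2) by blast
  ultimately show ?thesis by blast
qed

lemma two_face_systems_embeddings:
  assumes "polyhedral_cubic G \<Phi>" "polyhedral_cubic G \<Psi>" "scaffold_edges G \<Phi> = scaffold_edges G \<Psi>"
  shows "two_face_systems (\<lambda>u v. (u, v) \<in> parcs G) (set ` facial_walks G \<Phi>) (set ` facial_walks G \<Psi>)"
proof -
  interpret P: polyhedral_cubic G \<Phi> by fact
  interpret Q: polyhedral_cubic G \<Psi> by fact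
  show ?thesis
    using scaffold_exchange[OF assms] scaffold_exchange[OF assms(2,1) assms(3)[symmetric]]
      P.vertex_nb3 P.adj_verts
    by unfold_locales blast+
qed

lemma (in polyhedral_cubic) connected_closed_set:
  assumes "v \<in> S" "v \<in> pverts G" "\<And>u w. u \<in> S \<Longrightarrow> adj u w \<Longrightarrow> w \<in> S"
  shows "pverts G \<subseteq> S"
proof
  fix w assume w: "w \<in> pverts G"
  have "Digraph_Component.connected (with_proj G)"
    using polyhedral by (simp add: polyhedral_embedding_def is_embedding_def)
  then have "(v, w) \<in> rtrancl_on (pverts G) ((parcs G)\<^sup>s)"
    using w assms(2) unfolding connected_conv with_proj_simps by blast
  then show "w \<in> S"
  proof (induction rule: rtrancl_on_induct)
    case base
    then show ?case using assms(1) by simp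
  next
    case (step y z)
    have "adj y z" using step(2) adj_sym by (auto simp: symcl_def)
    then show ?case using step(5) assms(3) by blast
  qed
qed

section \<open>The Franklin graph\<close>

text \<open>\<open>i + 11\<close> and \<open>i + 7\<close> are \<open>i - 1\<close> and
  \<open>i - 5\<close> modulo 12, written without truncated subtraction.\<close>

definition franklin_nbrs :: "nat \<Rightarrow> nat list" where
  "franklin_nbrs i = [(i + 1) mod 12, (i + 11) mod 12, (if even i then i + 5 else i + 7) mod 12]"

text \<open>
  The indices 0, ..., 11 along the Hamiltonian cycle of the LCF notation stand for the vertices
  \<open>t0, t1, t2, t3, t4, t5, x5, x2, t0', t5', t4', x0\<close> of the theorem.
\<close>

definition franklin_faces :: "nat list list" where
  "franklin_faces = [[0, 1, 2, 3, 10, 11], [0, 1, 8, 9, 4, 5], [7, 2, 3, 4, 5, 6], [8, 9, 10, 11, 6, 7],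
     [1, 2, 7, 8], [3, 4, 9, 10], [0, 5, 6, 11]]"

text \<open>One direction per path: six paths for each hexagon and four for each square, 36 in all,
  matching 12 single and 12 double scaffold edges.\<close>

definition franklin_paths :: "nat list list" where
  "franklin_paths = concat (map (\<lambda>C. map (\<lambda>i. take 4 (rotate i C)) [0..<length C]) franklin_faces)"

lemma list_all_upt: "list_all P [0..<n] \<longleftrightarrow> (\<forall>i<n. P i)"
  by (auto simp: list_all_iff)

lemma franklin_nbrs_le: "list_all (\<lambda>i. list_all (\<lambda>j. j < 12 \<and> j \<noteq> i) (franklin_nbrs i) \<and> distinct (franklin_nbrs i)) [0..<12]"
  by code_simp

lemma franklin_parcs:
  "parcs franklin_graph = {(i, j). i < 12 \<and> j \<in> set (franklin_nbrs i)}"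
proof -
  have "list_all (\<lambda>u. list_all (\<lambda>v. (v = (u + 1) mod 12 \<or> u = (v + 1) mod 12 \<or>
          even u \<and> v = (u + 5) mod 12 \<or> even v \<and> u = (v + 5) mod 12) \<longleftrightarrow> v \<in> set (franklin_nbrs u)) [0..<12]) [0..<12]"
    by code_simp
  then have iff: "(v = (u + 1) mod 12 \<or> u = (v + 1) mod 12 \<or>
      even u \<and> v = (u + 5) mod 12 \<or> even v \<and> u = (v + 5) mod 12) \<longleftrightarrow> v \<in> set (franklin_nbrs u)"
    if "u < 12" "v < 12" for u v :: nat
    using that unfolding list_all_upt by blast
  have le: "v < 12" if "u < 12" "v \<in> set (franklin_nbrs u)" for u v
    using franklin_nbrs_le that unfolding list_all_upt by (simp add: list_all_iff)
  show ?thesis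
    unfolding franklin_graph_def pair_pre_digraph.simps
    by (intro Collect_cong prod.case_cong refl) (use iff le in blast)
qed

lemma franklin_paths_facts:
  "list_all (\<lambda>p. list_all (\<lambda>i. i < 12) p \<and> length p = 4 \<and> distinct p \<and> rev p \<notin> set franklin_paths \<and>
     p ! 1 \<in> set (franklin_nbrs (p ! 0)) \<and> p ! 2 \<in> set (franklin_nbrs (p ! 1)) \<and> p ! 3 \<in> set (franklin_nbrs (p ! 2)) \<and>
     (\<exists>C\<in>set franklin_faces. set p \<subseteq> set C)) franklin_paths"
  "distinct franklin_paths"
  by code_simp+

text \<open>A certificate that no facial path is missing: an unlisted walk without backtracking
  shares its first three vertices with a listed path that leaves \<open>k\<close> towards the other
  neighbour, and a face can leave a corner only one way.\<close>

lemma franklin_paths_complete: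
  "list_all (\<lambda>i. list_all (\<lambda>j. list_all (\<lambda>k. k = i \<or> list_all (\<lambda>l. l = j \<or>
      [i, j, k, l] \<in> set franklin_paths \<or> [l, k, j, i] \<in> set franklin_paths \<or>
      list_ex (\<lambda>l'. l' \<noteq> j \<and> l' \<noteq> l \<and> ([i, j, k, l'] \<in> set franklin_paths \<or> [l', k, j, i] \<in> set franklin_paths))
        (franklin_nbrs k))
    (franklin_nbrs k)) (franklin_nbrs j)) (franklin_nbrs i)) [0..<12]"
  by code_simp


text \<open>The ends of a path along three sides of a square are joined by its fourth side, so the
  sides of the three squares occur once. Antipodal vertices of a hexagon are joined by its two
  halves and form the double edges.\<close>

definition franklin_singles :: "(nat \<times> nat) list" where
  "franklin_singles = [(0, 5), (5, 6), (6, 11), (11, 0), (1, 2), (2, 7), (7, 8), (8, 1), (3, 10), (10, 9), (9, 4), (4, 3)]"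

definition franklin_doubles :: "(nat \<times> nat) list" where
  "franklin_doubles = [(0, 3), (11, 2), (1, 10), (8, 5), (4, 7), (6, 9), (0, 9), (1, 4), (2, 5), (3, 6), (10, 7), (11, 8)]"

text \<open>A normal form of an unordered pair, so that equality of multisets of edges can be
  decided by sorting.\<close>

definition ordered :: "nat \<times> nat \<Rightarrow> nat \<times> nat" where
  "ordered p = (min (fst p) (snd p), max (fst p) (snd p))"

lemma franklin_ends:
  "sort (map (\<lambda>p. ordered (p ! 0, p ! 3)) franklin_paths) =
   sort (map ordered (franklin_singles @ franklin_doubles @ franklin_doubles))"
  "distinct (map ordered (franklin_singles @ franklin_doubles))"
  "list_all (\<lambda>(i, j). i < 12 \<and> j < 12) (franklin_singles @ franklin_doubles)"
  by code_simp+

section \<open>Graphs labelled by the Franklin graph\<close>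

text \<open>The listed cycles need only be contained in faces; that there are no other facial paths
  follows from \<open>franklin_paths_complete\<close>.\<close>

locale franklin_labelling = polyhedral_cubic +
  fixes vs :: "'a list"
  assumes length_vs: "length vs = 12" and distinct_vs: "distinct vs" and set_vs: "set vs = pverts G"
    and nbrs_vs: "i < 12 \<Longrightarrow> nbrs G (vs ! i) = (!) vs ` set (franklin_nbrs i)"
    and faces_vs: "C \<in> set franklin_faces \<Longrightarrow> \<exists>F\<in>set ` facial_walks G \<Phi>. (!) vs ` set C \<subseteq> F"
begin

lemma vs_eq_iff: "i < 12 \<Longrightarrow> j < 12 \<Longrightarrow> vs ! i = vs ! j \<longleftrightarrow> i = j"
  using distinct_vs length_vs by (simp add: nth_eq_iff_index_eq)

lemma vertex_index: "v \<in> pverts G \<Longrightarrow> \<exists>i<12. v = vs ! i"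
  using set_vs length_vs by (metis in_set_conv_nth)

lemma franklin_nbr: "i < 12 \<Longrightarrow> j \<in> set (franklin_nbrs i) \<Longrightarrow> j < 12 \<and> j \<noteq> i"
  using franklin_nbrs_le unfolding list_all_upt by (simp add: list_all_iff)

lemma adj_index: "i < 12 \<Longrightarrow> adj (vs ! i) v \<Longrightarrow> \<exists>j\<in>set (franklin_nbrs i). v = vs ! j"
  using nbrs_vs[of i] by blast

lemma adj_nth: "i < 12 \<Longrightarrow> j \<in> set (franklin_nbrs i) \<Longrightarrow> adj (vs ! i) (vs ! j)"
  using nbrs_vs[of i] by blast

lemma franklin_path:
  assumes "p \<in> set franklin_paths" obtains i j k l where "p = [i, j, k, l]"
proof -
  have "length p = 4" using franklin_paths_facts(1) assms unfolding list_all_iff by blast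
  then show thesis using that by (auto simp: numeral_eq_Suc length_Suc_conv)
qed

lemma franklin_pathD:
  assumes "[i, j, k, l] \<in> set franklin_paths"
  shows "i < 12" "j < 12" "k < 12" "l < 12" "distinct [i, j, k, l]"
    "j \<in> set (franklin_nbrs i)" "k \<in> set (franklin_nbrs j)" "l \<in> set (franklin_nbrs k)"
    "\<exists>C\<in>set franklin_faces. {i, j, k, l} \<subseteq> set C"
proof -
  let ?p = "[i, j, k, l]"
  have "(\<forall>i\<in>set ?p. i < 12) \<and> distinct ?p \<and>
     ?p ! 1 \<in> set (franklin_nbrs (?p ! 0)) \<and> ?p ! 2 \<in> set (franklin_nbrs (?p ! 1)) \<and> ?p ! 3 \<in> set (franklin_nbrs (?p ! 2)) \<and>
     (\<exists>C\<in>set franklin_faces. set ?p \<subseteq> set C)"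
    using franklin_paths_facts(1) assms unfolding list_all_iff by blast
  then show "i < 12" "j < 12" "k < 12" "l < 12" "distinct [i, j, k, l]"
    "j \<in> set (franklin_nbrs i)" "k \<in> set (franklin_nbrs j)" "l \<in> set (franklin_nbrs k)"
    "\<exists>C\<in>set franklin_faces. {i, j, k, l} \<subseteq> set C" by (simp_all add: numeral_eq_Suc)
qed

lemma franklin_path_fp:
  assumes "[i, j, k, l] \<in> set franklin_paths"
  shows "F.fp (vs ! i) (vs ! j) (vs ! k) (vs ! l)"
proof -
  note p = franklin_pathD[OF assms]
  then obtain C where C: "C \<in> set franklin_faces" "{i, j, k, l} \<subseteq> set C" by blast
  obtain F where F: "F \<in> set ` facial_walks G \<Phi>" "(!) vs ` set C \<subseteq> F" using faces_vs[OF C(1)] by blast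
  have m: "vs ! i \<in> F" "vs ! j \<in> F" "vs ! k \<in> F" "vs ! l \<in> F" using F(2) C(2) by blast+
  show ?thesis
    by (rule F.fpI[OF F(1) m]) (use p adj_nth vs_eq_iff in simp_all)
qed

lemma fp_franklin_path:
  assumes f: "F.fp a b c d"
  shows "\<exists>p\<in>set franklin_paths. [a, b, c, d] = map ((!) vs) p \<or> [d, c, b, a] = map ((!) vs) p"
proof -
  have ne: "a \<noteq> c" "b \<noteq> d" and e: "adj a b" "adj b c" "adj c d"
    using F.fp_path[OF f] by auto
  obtain i where i: "i < 12" "a = vs ! i" using vertex_index adj_verts(1)[OF e(1)] by blast
  obtain j where j: "j \<in> set (franklin_nbrs i)" "b = vs ! j" using adj_index i e(1) by blast
  have j12: "j < 12" using franklin_nbr[OF i(1) j(1)] by blast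
  obtain k where k: "k \<in> set (franklin_nbrs j)" "c = vs ! k" using adj_index j j12 e(2) by blast
  have k12: "k < 12" using franklin_nbr[OF j12 k(1)] by blast
  obtain l where l: "l \<in> set (franklin_nbrs k)" "d = vs ! l" using adj_index k k12 e(3) by blast
  have l12: "l < 12" using franklin_nbr[OF k12 l(1)] by blast
  have "k \<noteq> i" "l \<noteq> j" using ne i j k l by auto
  then consider "[i, j, k, l] \<in> set franklin_paths" | "[l, k, j, i] \<in> set franklin_paths"
    | l' where "l' \<in> set (franklin_nbrs k)" "l' \<noteq> j" "l' \<noteq> l"
      "[i, j, k, l'] \<in> set franklin_paths \<or> [l', k, j, i] \<in> set franklin_paths"
    using franklin_paths_complete i(1) j(1) k(1) l(1)
    unfolding list_all_upt by (simp only: list_all_iff list_ex_iff) blast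
  then show ?thesis
  proof cases
    case 1
    then show ?thesis using i j k l by (intro bexI[of _ "[i, j, k, l]"]) auto
  next
    case 2
    then show ?thesis using i j k l by (intro bexI[of _ "[l, k, j, i]"]) auto
  next
    case (3 l')
    then have f': "F.fp a b c (vs ! l')"
      using franklin_path_fp F.fp_sym i j k by blast
    obtain F where F: "F \<in> set ` facial_walks G \<Phi>" "a \<in> F" "b \<in> F" "c \<in> F" "d \<in> F"
      using f by (rule F.fpE)
    \<comment> \<open>The face of \<open>a b c d\<close> would contain \<open>b\<close>,
      \<open>d\<close> and the vertex labelled \<open>l'\<close>, all three neighbours of
      \<open>c\<close>.\<close>
    have l': "vs ! l' \<in> F" by (rule F.fp_face[OF f' F(1-4)])
    have "l' < 12" using franklin_nbr[OF k12 3(1)] by blast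
    then have ne': "vs ! l' \<noteq> b" "vs ! l' \<noteq> d" using 3 j l j12 l12 vs_eq_iff by auto
    obtain x where x: "nb3 adj c b d x"
      using vertex_nb3[OF adj_verts(1)[OF e(3)]] nb3_complete adj_sym[OF e(2)] e(3) ne(2) by metis
    have "vs ! l' = x" using nb3D(7)[OF x] ne' adj_nth[OF k12 3(1)] k by blast
    then show ?thesis using F.face_nb3[OF x F(1,4)] F l' by blast
  qed
qed

definition labelled_paths :: "'a list list" where
  "labelled_paths = map (map ((!) vs)) franklin_paths"

lemma facial_3paths_labelled: "facial_3paths G \<Phi> = set labelled_paths \<union> rev ` set labelled_paths"
proof (intro set_eqI iffI)
  fix p assume "p \<in> facial_3paths G \<Phi>"
  then obtain a b c d where p: "p = [a, b, c, d]" "F.fp a b c d" unfolding facial_3paths_eq by blast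
  obtain q where q: "q \<in> set franklin_paths" "[a, b, c, d] = map ((!) vs) q \<or> [d, c, b, a] = map ((!) vs) q"
    using fp_franklin_path[OF p(2)] by (elim bexE)
  have "p = map ((!) vs) q \<or> p = rev (map ((!) vs) q)"
  proof (cases "[a, b, c, d] = map ((!) vs) q")
    case False
    then have "map ((!) vs) q = [d, c, b, a]" using q(2) by simp
    then show ?thesis using p(1) by simp
  qed (use p(1) in simp)
  then show "p \<in> set labelled_paths \<union> rev ` set labelled_paths"
    using q(1) unfolding labelled_paths_def by auto
next
  fix p assume "p \<in> set labelled_paths \<union> rev ` set labelled_paths"
  then obtain q where q: "q \<in> set franklin_paths" "p = map ((!) vs) q \<or> p = rev (map ((!) vs) q)"
    unfolding labelled_paths_def by auto
  obtain i j k l where e: "q = [i, j, k, l]" using q(1) by (rule franklin_path)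
  have "F.fp (vs ! i) (vs ! j) (vs ! k) (vs ! l)" using franklin_path_fp q(1) e by simp
  then show "p \<in> facial_3paths G \<Phi>"
    unfolding facial_3paths_eq using q(2) e F.fp_sym[of "vs ! i" "vs ! j" "vs ! k" "vs ! l"] by auto
qed

lemma map_vs_inj:
  assumes "\<forall>i\<in>set p. i < 12" "\<forall>i\<in>set q. i < 12" "map ((!) vs) p = map ((!) vs) q"
  shows "p = q"
proof -
  have "inj_on ((!) vs) (set p \<union> set q)"
    by (rule inj_onI) (use assms(1,2) vs_eq_iff in blast)
  then show ?thesis using assms(3) by (simp add: inj_on_map_eq_map)
qed

lemma franklin_path_bound: "p \<in> set franklin_paths \<Longrightarrow> \<forall>i\<in>set p. i < 12"
  using franklin_paths_facts(1) unfolding list_all_iff by blast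

lemma distinct_labelled: "distinct labelled_paths"
  unfolding labelled_paths_def distinct_map
proof
  show "inj_on (map ((!) vs)) (set franklin_paths)"
    by (rule inj_onI) (rule map_vs_inj[OF franklin_path_bound franklin_path_bound])
qed (rule franklin_paths_facts(2))

text \<open>Each class is listed in one direction only. This lets the set of classes in the scaffold
  be replaced by the list of paths without losing multiplicities.\<close>

lemma inj_path_class: "inj_on (\<lambda>p. {p, rev p}) (set labelled_paths)"
proof (rule inj_onI)
  fix p q assume "p \<in> set labelled_paths" "q \<in> set labelled_paths" and eq: "{p, rev p} = {q, rev q}"
  then obtain p' q' where p': "p' \<in> set franklin_paths" "p = map ((!) vs) p'"
    and q': "q' \<in> set franklin_paths" "q = map ((!) vs) q'"
    unfolding labelled_paths_def by auto
  have "p \<noteq> rev q"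
  proof
    assume "p = rev q"
    then have "map ((!) vs) p' = map ((!) vs) (rev q')" using p' q' by (simp add: rev_map)
    then have "p' = rev q'" using map_vs_inj[of p' "rev q'"] franklin_path_bound p' q' by simp
    moreover have "rev q' \<notin> set franklin_paths"
      using franklin_paths_facts(1) q'(1) unfolding list_all_iff by blast
    ultimately show False using p'(1) by simp
  qed
  then show "p = q" using eq by (metis insertCI insertE singletonD)
qed

abbreviation label_edge :: "nat \<times> nat \<Rightarrow> 'a set" where
  "label_edge e \<equiv> {vs ! fst e, vs ! snd e}"

lemma label_edge_ordered: "label_edge (ordered e) = label_edge e"
  by (auto simp: ordered_def min_def max_def)

lemma scaffold_labelled:
  "scaffold_edges G \<Phi> =
    mset (map label_edge franklin_singles) + mset (map label_edge franklin_doubles) + mset (map label_edge franklin_doubles)"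
proof -
  let ?f = "\<lambda>P. \<Union>q\<in>P. {hd q, last q}"
  have "{{p, rev p} |p. p \<in> facial_3paths G \<Phi>} = (\<lambda>p. {p, rev p}) ` set labelled_paths"
    unfolding facial_3paths_labelled by auto
  then have "scaffold_edges G \<Phi> = image_mset ?f (mset_set ((\<lambda>p. {p, rev p}) ` set labelled_paths))"
    unfolding scaffold_edges_def by simp
  also have "\<dots> = image_mset ?f (image_mset (\<lambda>p. {p, rev p}) (mset labelled_paths))"
    using inj_path_class distinct_labelled by (simp flip: image_mset_mset_set add: mset_set_set)
  also have "\<dots> = image_mset (\<lambda>p. ?f {p, rev p}) (mset labelled_paths)"
    by (simp only: image_mset.compositionality comp_def)
  also have "\<dots> = mset (map (\<lambda>p. ?f {map ((!) vs) p, rev (map ((!) vs) p)}) franklin_paths)"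
    unfolding labelled_paths_def by (simp only: mset_map image_mset.compositionality comp_def)
  also have "\<dots> = mset (map (\<lambda>p. label_edge (ordered (p ! 0, p ! 3))) franklin_paths)"
  proof (intro arg_cong[of _ _ mset] map_cong refl)
    fix p assume "p \<in> set franklin_paths"
    then obtain i j k l where p: "p = [i, j, k, l]" by (rule franklin_path)
    show "?f {map ((!) vs) p, rev (map ((!) vs) p)} = label_edge (ordered (p ! 0, p ! 3))"
      unfolding label_edge_ordered p by (auto simp: numeral_eq_Suc)
  qed
  also have "\<dots> = image_mset label_edge (mset (map (\<lambda>p. ordered (p ! 0, p ! 3)) franklin_paths))"
    by (simp only: mset_map image_mset.compositionality comp_def)
  also have "mset (map (\<lambda>p. ordered (p ! 0, p ! 3)) franklin_paths) =
      mset (map ordered (franklin_singles @ franklin_doubles @ franklin_doubles))"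
    using arg_cong[OF franklin_ends(1), of mset] by (simp only: mset_sort)
  also have "image_mset label_edge \<dots> = mset (map label_edge (franklin_singles @ franklin_doubles @ franklin_doubles))"
    by (simp only: mset_map image_mset.compositionality comp_def label_edge_ordered)
  finally show ?thesis by (simp only: map_append mset_append add.assoc)
qed

lemma distinct_scaffold: "distinct (map label_edge (franklin_singles @ franklin_doubles))"
  unfolding distinct_map
proof
  let ?S = "franklin_singles @ franklin_doubles"
  show "distinct ?S" using franklin_ends(2) unfolding distinct_map by blast
  have inj: "inj_on ordered (set ?S)" using franklin_ends(2) unfolding distinct_map by blast
  show "inj_on label_edge (set ?S)"
  proof (rule inj_onI)
    fix x y assume xy: "x \<in> set ?S" "y \<in> set ?S" "label_edge x = label_edge y"
    have "fst x < 12 \<and> snd x < 12 \<and> fst y < 12 \<and> snd y < 12"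
      using franklin_ends(3) xy(1,2) unfolding list_all_iff by (auto simp: case_prod_beta)
    then have "{fst x, snd x} = {fst y, snd y}"
      using xy(3) vs_eq_iff by (metis doubleton_eq_iff)
    then have "ordered x = ordered y" unfolding ordered_def by (auto simp: doubleton_eq_iff)
    then show "x = y" using inj xy(1,2) by (meson inj_onD)
  qed
qed

lemma parcs_labelled: "parcs G = (\<lambda>(i, j). (vs ! i, vs ! j)) ` parcs franklin_graph"
proof
  show "parcs G \<subseteq> (\<lambda>(i, j). (vs ! i, vs ! j)) ` parcs franklin_graph"
  proof
    fix e assume "e \<in> parcs G"
    then obtain u v where uv: "e = (u, v)" "adj u v" by (cases e) auto
    obtain i where i: "i < 12" "u = vs ! i" using vertex_index adj_verts(1)[OF uv(2)] by blast
    obtain j where j: "j \<in> set (franklin_nbrs i)" "v = vs ! j" using adj_index i uv(2) by blast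
    have "(i, j) \<in> parcs franklin_graph" using i j by (simp add: franklin_parcs)
    then show "e \<in> (\<lambda>(i, j). (vs ! i, vs ! j)) ` parcs franklin_graph"
      using uv i j by force
  qed
  show "(\<lambda>(i, j). (vs ! i, vs ! j)) ` parcs franklin_graph \<subseteq> parcs G"
    using adj_nth by (auto simp: franklin_parcs)
qed

lemma iso_franklin: "digraph_iso (with_proj G) (with_proj franklin_graph)"
proof -
  \<comment> \<open>The isomorphism starts at \<open>G\<close>, so the labelling is inverted; arcs
    are pairs and are mapped componentwise.\<close>
  let ?g = "the_inv_into {..<12} ((!) vs)"
  let ?f = "\<lparr> iso_verts = ?g, iso_arcs = map_prod ?g ?g, iso_head = snd, iso_tail = fst \<rparr>"
  have inj: "inj_on ((!) vs) {..<12}" using vs_eq_iff by (auto intro: inj_onI)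
  have img: "(!) vs ` {..<12} = pverts G"
    using set_vs length_vs by (metis lessThan_atLeast0 list.set_map map_nth set_upt)
  have g: "?g (vs ! i) = i" if "i < 12" for i using the_inv_into_f_f[OF inj] that by simp
  have bij: "bij_betw ?g (pverts G) {..<12}"
    using bij_betw_the_inv_into[of "(!) vs" "{..<12}" "pverts G"] inj img by (simp add: bij_betw_def)
  have "inj_on (map_prod ?g ?g) (pverts G \<times> pverts G)"
    using bij by (intro map_prod_inj_on) (simp_all add: bij_betw_def)
  then have inja: "inj_on (map_prod ?g ?g) (parcs G)"
    by (rule inj_on_subset) (use adj_verts in auto)
  have "map_prod ?g ?g ` parcs G = (\<lambda>e. e) ` parcs franklin_graph"
    unfolding parcs_labelled image_image
  proof (rule image_cong[OF refl])
    fix e assume "e \<in> parcs franklin_graph"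
    then have "fst e < 12" "snd e < 12" by (auto simp: franklin_graph_def)
    then show "map_prod ?g ?g (case e of (i, j) \<Rightarrow> (vs ! i, vs ! j)) = e"
      using g by (cases e) simp
  qed
  then have arcs: "map_prod ?g ?g ` parcs G = parcs franklin_graph" by simp
  have "pre_digraph.digraph_isomorphism (with_proj G) ?f"
    unfolding pre_digraph.digraph_isomorphism_def
    using bij inja wf_digraph_axioms by (simp add: bij_betw_def)
  moreover have "with_proj franklin_graph = app_iso ?f (with_proj G)"
    using bij arcs unfolding app_iso_def with_proj_def bij_betw_def by (simp add: franklin_graph_def)
  ultimately show ?thesis unfolding digraph_iso_def by blast
qed

end

section \<open>From the butterfly to the labelled Franklin graph\<close>

lemma cycle_parcs:
  assumes "is_cycle (pair_pre_digraph.truncate Ge) [a, b, c, d, e, f]"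
  shows "{(a, b), (b, c), (c, d), (d, e), (e, f), (f, a)} \<subseteq> parcs Ge"
  using assms by (simp add: is_cycle_def vwalk_def pair_pre_digraph.truncate_def)

lemma nb3_nbrs: "nb3 (\<lambda>u v. (u, v) \<in> parcs G) v a b c \<Longrightarrow> nbrs G v = {a, b, c}"
  by (auto simp: nb3_def)

lemma less_12_cases:
  assumes "P 0" "P 1" "P 2" "P 3" "P 4" "P 5" "P 6" "P 7" "P 8" "P 9" "P 10" "P 11" "i < (12::nat)"
  shows "P i"
proof -
  have "i = 0 \<or> i = 1 \<or> i = 2 \<or> i = 3 \<or> i = 4 \<or> i = 5 \<or> i = 6 \<or> i = 7 \<or> i = 8 \<or> i = 9 \<or> i = 10 \<or> i = 11"
    using assms(13) by arith
  then show ?thesis using assms(1-12) by (elim disjE) simp_all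
qed

lemma (in butterfly) franklin_faces_exist:
  assumes "C \<in> set franklin_faces"
  shows "\<exists>F\<in>\<F>1. (!) [t0, t1, t2, t3, t4, t5, x5, x2, p0, p5, p4, x0] ` set C \<subseteq> F"
proof -
  have "\<exists>F\<in>\<F>1. {t0, t1, t2, t3, p4, x0} \<subseteq> F" using A1_face by (metis empty_subsetI insert_subset)
  moreover have "\<exists>F\<in>\<F>1. {t0, t1, p0, p5, t4, t5} \<subseteq> F" using P_face' by (metis empty_subsetI insert_subset)
  moreover have "\<exists>F\<in>\<F>1. {x2, t2, t3, t4, t5, x5} \<subseteq> F" "\<exists>F\<in>\<F>1. {p0, p5, p4, x0, x5, x2} \<subseteq> F"
    using third_faces by metis+
  moreover have "\<exists>F\<in>\<F>1. {t1, t2, x2, p0} \<subseteq> F"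
    using S1.four_cycle_facial[of t1 t2 x2 p0] edges p0_x2 x2_neqs neqs nb3D(7)[OF nt1] by auto
  moreover have "\<exists>F\<in>\<F>1. {t3, t4, p5, p4} \<subseteq> F"
    using S1.four_cycle_facial[of t3 t4 p5 p4] edges edges9 t4_p5 neqs t3_p5 by auto
  moreover have "\<exists>F\<in>\<F>1. {t0, t5, x5, x0} \<subseteq> F"
    using S1.four_cycle_facial[of t0 t5 x5 x0] edges9 nb3D(2)[OF nx5] x5_neqs x5_neqs' x0_neqs neqs
      nb3D(7)[OF nt0] by auto
  ultimately show ?thesis
    using assms unfolding franklin_faces_def by (auto simp: insert_commute)
qed

theorem theorem17:
  fixes G :: "'a pair_pre_digraph"
    and \<Phi> :: "'a embedding"
    and Ge :: "'a extended_graph"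
    and t0 t0' t1 t2 t3 t4 t4' t5 t5' :: 'a
  assumes "pair_graph G"
    and "cubic G"
    and "polyhedral_embedding G \<Phi>"
    and "Ge = extended_graph G \<Phi>"
    and "butterfly_two Ge t0 t0' t1 t2 t3 t4 t4' t5 t5'"
    and "{t0', t3} \<notin># scaffold Ge"
    and "fork Ge t1 t2 t3 t4 t4'"
    and "\<not> fork_solvable G Ge t1 t2 t3 t4 t4'"
  shows "digraph_iso (with_proj G) (with_proj franklin_graph) \<and>
    (\<exists>x0 x2 x5.
       nbrs G t0 - {t0, t1, t2, t3, t4, t5} = {x0} \<and>
       nbrs G t2 - {t0, t1, t2, t3, t4, t5} = {x2} \<and>
       nbrs G t5 - {t0, t1, t2, t3, t4, t5} = {x5} \<and>
       (let singles =
              [{t0, t5}, {t5, x5}, {x5, x0}, {x0, t0},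
               {t1, t2}, {t2, x2}, {x2, t0'}, {t0', t1},
               {t3, t4'}, {t4', t5'}, {t5', t4}, {t4, t3}];
            doubles =
              [{t0, t3}, {x0, t2}, {t1, t4'}, {t0', t5},
               {t4, x2}, {x5, t5'}, {t0, t5'}, {t1, t4},
               {t2, t5}, {t3, x5}, {t4', x2}, {x0, t0'}]
        in distinct (singles @ doubles) \<and>
           scaffold Ge = mset singles + mset doubles + mset doubles))"
proof -
  let ?E = "\<lambda>u v. (u, v) \<in> parcs G"
  let ?S = "\<lambda>\<Psi>. set ` facial_walks G \<Psi>"
  have bf: "distinct [t0, t0', t1, t2, t3, t4, t4', t5, t5']"
    "is_cycle (pair_pre_digraph.truncate Ge) [t0, t1, t2, t3, t4, t5]"
    "is_cycle (pair_pre_digraph.truncate Ge) [t0', t1, t2, t3, t4', t5']"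
    using assms(5) unfolding butterfly_two_def by blast+
  have Ge: "parcs Ge = parcs G" using assms(4) by (simp add: extended_graph_def)
  interpret P: polyhedral_cubic G \<Phi> using assms(1-3) by (rule polyhedral_cubic.intro)
  have e: "?E t0 t1" "?E t1 t2" "?E t2 t3" "?E t3 t4" "?E t4 t5" "?E t5 t0"
    "?E t0' t1" "?E t3 t4'" "?E t4' t5'" "?E t5' t0'"
    using cycle_parcs[OF bf(2)] cycle_parcs[OF bf(3)] unfolding Ge by blast+
  note e' = e[THEN P.adj_sym]
  have nb: "\<exists>c. nb3 ?E v a b c" if "?E v a" "?E v b" "a \<noteq> b" for v a b
    using P.vertex_nb3[OF P.adj_verts(1)[OF that(1)]] nb3_complete that by metis
  have ne: "t1 \<noteq> t5" "t1 \<noteq> t3" "t3 \<noteq> t5" "t0 \<noteq> t4" "t1 \<noteq> t5'" "t3 \<noteq> t5'" "t0' \<noteq> t4'" "t0 \<noteq> t2" "t2 \<noteq> t4"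
    using bf(1) by auto
  obtain x0 where N0: "nb3 ?E t0 t1 t5 x0" using nb[OF e(1) e'(6) ne(1)] ..
  obtain x2 where N2: "nb3 ?E t2 t1 t3 x2" using nb[OF e'(2) e(3) ne(2)] ..
  obtain x4 where N4: "nb3 ?E t4 t3 t5 x4" using nb[OF e'(4) e(5) ne(3)] ..
  obtain x5 where N5: "nb3 ?E t5 t0 t4 x5" using nb[OF e(6) e'(5) ne(4)] ..
  obtain w0 where N0': "nb3 ?E t0' t1 t5' w0" using nb[OF e(7) e'(10) ne(5)] ..
  obtain w4 where N4': "nb3 ?E t4' t3 t5' w4" using nb[OF e'(8) e(9) ne(6)] ..
  obtain w5 where N5': "nb3 ?E t5' t0' t4' w5" using nb[OF e(10) e'(9) ne(7)] ..
  obtain y1 where y1: "nb3 ?E t1 t0 t2 y1" using nb[OF e'(1) e(2) ne(8)] ..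
  obtain y3 where y3: "nb3 ?E t3 t2 t4 y3" using nb[OF e'(3) e(4) ne(9)] ..
  have "y1 = t0'" "y3 = t4'"
    using nb3D(7)[OF y1, of t0'] nb3D(7)[OF y3, of t4'] e'(7) e(8) bf(1) by auto
  then have N1: "nb3 ?E t1 t0 t2 t0'" and N3: "nb3 ?E t3 t2 t4 t4'" using y1 y3 by simp_all
  \<comment> \<open>One witness against each disjunct: at \<open>t3\<close> the corner
    \<open>t1 t2 t3\<close> must continue to \<open>t4'\<close> in \<open>\<Phi>1\<close> and to
    \<open>t4\<close> in \<open>\<Phi>2\<close>.\<close>
  obtain \<Phi>1 \<Phi>2 where
    \<Phi>1: "polyhedral_embedding G \<Phi>1" "extended_graph G \<Phi>1 = Ge" "\<not> facial_subwalk G \<Phi>1 [t1, t2, t3, t4]" and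
    \<Phi>2: "polyhedral_embedding G \<Phi>2" "extended_graph G \<Phi>2 = Ge" "\<not> facial_subwalk G \<Phi>2 [t1, t2, t3, t4']"
    using assms(8) unfolding fork_solvable_def by blast
  have Q: "polyhedral_cubic G \<Phi>1" "polyhedral_cubic G \<Phi>2"
    using assms(1,2) \<Phi>1(1) \<Phi>2(1) by (auto intro: polyhedral_cubic.intro)
  interpret P1: polyhedral_cubic G \<Phi>1 by (rule Q(1))
  interpret P2: polyhedral_cubic G \<Phi>2 by (rule Q(2))
  have sc: "scaffold_edges G \<Phi>1 = scaffold Ge" "scaffold_edges G \<Phi>2 = scaffold Ge"
    using \<Phi>1(2) \<Phi>2(2) by (auto simp: extended_graph_def)
  interpret two_face_systems ?E "?S \<Phi>1" "?S \<Phi>2"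
    using two_face_systems_embeddings[OF Q] sc by simp
  have n1: "\<not> P1.F.fp t1 t2 t3 t4" using P1.path_facial_iff[of t1 t2 t3 t4] \<Phi>1(3) e bf(1) by auto
  have n2: "\<not> P2.F.fp t1 t2 t3 t4'" using P2.path_facial_iff[of t1 t2 t3 t4'] \<Phi>2(3) e bf(1) by auto
  have bent1: "P1.F.fp t1 t2 t3 t4'"
    by (rule P1.F.fp_other_end[OF nb3_swap(2)[OF N2] N3 n1]) (use bf(1) in auto)
  have bent2: "P2.F.fp t1 t2 t3 t4"
    by (rule P2.F.fp_other_end[OF nb3_swap(2)[OF N2] nb3_swap(2)[OF N3] n2]) (use bf(1) in auto)
  have N2': "nb3 ?E t2 t3 x2 t1" by (rule nb3_swap(2)[OF nb3_swap(1)[OF N2]])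
  have N1': "nb3 ?E t1 t2 t0' t0" by (rule nb3_swap(2)[OF nb3_swap(1)[OF N1]])
  \<comment> \<open>A facial path from \<open>t3\<close> through \<open>t2\<close> and
    \<open>t1\<close> to \<open>t0'\<close> would make \<open>[t0' t3]\<close> a scaffold edge; so
    both embeddings turn to \<open>t0\<close>.\<close>
  have no: "{t3, t0'} \<notin># scaffold Ge" using assms(6) by (simp add: insert_commute)
  have m1: "\<not> P1.F.fp t3 t2 t1 t0'" using no P1.in_scaffold_iff[of t3 t0'] sc by auto
  have m2: "\<not> P2.F.fp t3 t2 t1 t0'" using no P2.in_scaffold_iff[of t3 t0'] sc by auto
  have "P1.F.fp t3 t2 t1 t0"
    by (rule P1.F.fp_other_end[OF N2' N1' m1]) (use bf(1) in auto)
  then have ends1: "P1.F.fp t0 t1 t2 t3" by (rule P1.F.fp_sym)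
  have "P2.F.fp t3 t2 t1 t0"
    by (rule P2.F.fp_other_end[OF N2' N1' m2]) (use bf(1) in auto)
  then have ends2: "P2.F.fp t0 t1 t2 t3" by (rule P2.F.fp_sym)
  interpret B: butterfly ?E "?S \<Phi>1" "?S \<Phi>2" t0 t1 t2 t3 t4 t4' t0' x2 t5 t5' x0 x4 x5 w0 w4 w5
  proof unfold_locales
    show "distinct [t0, t1, t2, t3, t4, t4', t0']" "distinct [t0, t1, t2, t3, t4, t5, t0', t4', t5']"
      using bf(1) by auto
  qed (fact N0 N1 N2 N3 N4 N5 N0' N4' N5' bent1 bent2 ends1 ends2)+
  let ?vs = "[t0, t1, t2, t3, t4, t5, x5, x2, t0', t5', t4', x0]"
  note nbrs12 = B.nt0[THEN nb3_nbrs] B.nt1[THEN nb3_nbrs] B.nt2[THEN nb3_nbrs] B.nt3[THEN nb3_nbrs]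
    B.nt4'[THEN nb3_nbrs] B.nt5[THEN nb3_nbrs] B.np0'[THEN nb3_nbrs] B.np4'[THEN nb3_nbrs]
    B.np5'[THEN nb3_nbrs] B.closing_vertex[THEN nb3_nbrs] B.nx5[THEN nb3_nbrs]
  \<comment> \<open>All neighbours of the twelve vertices are among them, so connectedness leaves no
    further vertex.\<close>
  have vs: "set ?vs = pverts G"
  proof
    have "\<forall>u\<in>set ?vs. nbrs G u \<subseteq> set ?vs" unfolding list.set ball_simps nbrs12 by simp
    then have closed: "w \<in> set ?vs" if "u \<in> set ?vs" "?E u w" for u w using that by blast
    show "pverts G \<subseteq> set ?vs"
    proof (rule P.connected_closed_set)
      show "t0 \<in> set ?vs" by simp
    qed (fact P.adj_verts(1)[OF e(1)], fact closed)
    have "\<forall>u\<in>set ?vs. nbrs G u \<noteq> {}" unfolding list.set ball_simps nbrs12 by simp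
    then show "set ?vs \<subseteq> pverts G" using P.adj_verts(1) by blast
  qed
  \<comment> \<open>The faces known in full are those of \<open>\<Phi>1\<close>, whose scaffold is
    that of \<open>Ge\<close>.\<close>
  interpret L: franklin_labelling G \<Phi>1 ?vs
  proof unfold_locales
    show "length ?vs = 12" by simp
    show "distinct ?vs" using B.distinct12 by auto
    show "set ?vs = pverts G" by (rule vs)
    show "nbrs G (?vs ! i) = (!) ?vs ` set (franklin_nbrs i)" if "i < 12" for i
      using that by (rule less_12_cases[rotated 12]) (simp_all add: nbrs12 franklin_nbrs_def insert_commute)
    show "\<exists>F\<in>?S \<Phi>1. (!) ?vs ` set C \<subseteq> F" if "C \<in> set franklin_faces" for C
      using that by (rule B.franklin_faces_exist)
  qed
  have "map L.label_edge franklin_singles =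
      [{t0, t5}, {t5, x5}, {x5, x0}, {x0, t0}, {t1, t2}, {t2, x2}, {x2, t0'}, {t0', t1},
       {t3, t4'}, {t4', t5'}, {t5', t4}, {t4, t3}]" (is "_ = ?singles")
    by (simp add: franklin_singles_def)
  moreover have "map L.label_edge franklin_doubles =
      [{t0, t3}, {x0, t2}, {t1, t4'}, {t0', t5}, {t4, x2}, {x5, t5'}, {t0, t5'}, {t1, t4},
       {t2, t5}, {t3, x5}, {t4', x2}, {x0, t0'}]" (is "_ = ?doubles")
    by (simp add: franklin_doubles_def)
  ultimately have S: "distinct (?singles @ ?doubles)"
    "scaffold Ge = mset ?singles + mset ?doubles + mset ?doubles"
    using L.distinct_scaffold L.scaffold_labelled sc(1) by (simp_all only: map_append)
  have x: "nbrs G t0 - {t0, t1, t2, t3, t4, t5} = {x0}"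
    "nbrs G t2 - {t0, t1, t2, t3, t4, t5} = {x2}"
    "nbrs G t5 - {t0, t1, t2, t3, t4, t5} = {x5}"
    unfolding nbrs12 using B.distinct12 by auto
  show ?thesis
    unfolding Let_def using L.iso_franklin x S by blast
qed

end
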